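(* Let $J\subseteq(-\infty,1]$ be an interval and let $\lambda:J\to[0,1]$ be a continuous function such that the function $\alpha\mapsto\lambda(\alpha)\chi_2(\alpha)$ is non-decreasing on $J$. Then the family $\left\{\mathfrak{G}_\alpha^{\lambda(\alpha)}\right\}_{\alpha\in J}$ is a strict filtration of $\mathcal{G}_0$ with non-empty boundaries of its sets. Moreover, it admits a net of totally extremal functions.
   Context: Let $\mathbb{D}$ be the open unit disk. $\mathcal{A}$ is the set of holomorphic $f:\mathbb{D}\to\mathbb{C}$ with $f(0)=0$, $f'(0)=1$; quotients $f(z)/z$ are extended by their limit at $0$. $\mathcal{G}_0=\{f\in\mathcal{A}:\operatorname{Re}(f(z)/z)>0,\ z\in\mathbb{D}\}$. For $\alpha\le1$, $\lambda\in[0,1]$, $$\mathfrak{G}_\alpha^\lambda=\left\{f\in\mathcal{A}:\ \operatorname{Re}\left[\alpha\frac{f(z)}{z}+(1-\alpha)f'(z)\right]\ge1-\lambda,\ z\in\mathbb{D}\setminus\{0\}\right\}.$$ $\varkappa(\alpha)=\int_0^1\frac{1-t^{1-\alpha}}{1+t^{1-\alpha}}\,dt$ for $\alpha\le1$, and $\chi_2(\alpha)=\frac{\varkappa(\alpha)}{1-\alpha}$ for $\alpha<1$, with $\chi_2(1):=\lim_{\alpha\to1^-}\chi_2(\alpha)=\frac12$. A filtration of $\mathcal{G}_0$ is a family $\{\mathfrak{F}_s\}_{s\in J}$ of subsets of $\mathcal{G}_0$ with $\mathfrak{F}_s\subseteq\mathfrak{F}_t$ for $s\le t$. It is strict if $\mathfrak{F}_s\subsetneq\mathfrak{F}_t$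 for $s<t$. The boundary is $\partial\mathfrak{F}_t=\mathfrak{F}_t\setminus\bigcup_{s\in J,\,s<t}\mathfrak{F}_s$. A function $f_*\in\mathcal{F}\subset\mathcal{A}$ is totally extremal for $\mathcal{F}$ if for all $c\in\mathbb{C}$, $r\in[0,1)$ and $f\in\mathcal{F}$: $\min_{|z|=r}\operatorname{Re}\left(c\frac{f(z)}{z}\right)\ge\min_{|z|=r}\operatorname{Re}\left(c\frac{f_*(z)}{z}\right)$. A filtration $\{\mathfrak{F}_s\}_{s\in J}$ admits a net $\{f_s\}_{s\in J}$ of totally extremal functions if each $f_s$ is totally extremal for $\mathfrak{F}_s$.
   Formalization: The formal theorem additionally assumes that λ vanishes at no more than one point of J; if λ(a)=λ(b)=0 with a<b (e.g. λ≡0), both sets equal {z}, so the filtration is not strict and the boundary at b is empty. *)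

theory Defs
  imports "HOL-Complex_Analysis.Complex_Analysis"
begin

text \<open>
  Functions on the unit disk are represented by total functions on the complex plane whose values
  outside the disk are irrelevant: membership in each of the classes below depends only on the
  restriction to the open unit disk.
\<close>

definition class_A :: "(complex \<Rightarrow> complex) set" where
  "class_A = {f. f holomorphic_on ball 0 1 \<and> f 0 = 0 \<and> deriv f 0 = 1}"

definition quot :: "(complex \<Rightarrow> complex) \<Rightarrow> complex \<Rightarrow> complex" where
  "quot f z = (if z = 0 then Lim (at 0) (\<lambda>w. f w / w) else f z / z)"

definition class_G0 :: "(complex \<Rightarrow> complex) set" where
  "class_G0 = {f \<in> class_A. \<forall>z\<in>ball 0 1. Re (quot f z) > 0}"

definition class_G :: "real \<Rightarrow> real \<Rightarrow> (complex \<Rightarrow> complex) set" where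
  "class_G \<alpha> l = {f \<in> class_A. \<forall>z\<in>ball 0 1 - {0}.
     Re (complex_of_real \<alpha> * (f z / z) + complex_of_real (1 - \<alpha>) * deriv f z) \<ge> 1 - l}"

definition varkappa :: "real \<Rightarrow> real" where
  "varkappa \<alpha> = integral {0..1} (\<lambda>t. (1 - t powr (1 - \<alpha>)) / (1 + t powr (1 - \<alpha>)))"

text \<open>Only arguments \<open>\<alpha> \<le> 1\<close> are meaningful; the limit at \<open>1\<close> is \<open>1/2\<close>.\<close>

definition chi2 :: "real \<Rightarrow> real" where
  "chi2 \<alpha> = (if \<alpha> < 1 then varkappa \<alpha> / (1 - \<alpha>)
             else Lim (at_left 1) (\<lambda>x. varkappa x / (1 - x)))"

definition filtration_of :: "'a set \<Rightarrow> real set \<Rightarrow> (real \<Rightarrow> 'a set) \<Rightarrow> bool" where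
  "filtration_of G J F \<longleftrightarrow>
     (\<forall>s\<in>J. F s \<subseteq> G) \<and> (\<forall>s\<in>J. \<forall>t\<in>J. s \<le> t \<longrightarrow> F s \<subseteq> F t)"

definition strict_filtration_of :: "'a set \<Rightarrow> real set \<Rightarrow> (real \<Rightarrow> 'a set) \<Rightarrow> bool" where
  "strict_filtration_of G J F \<longleftrightarrow>
     filtration_of G J F \<and> (\<forall>s\<in>J. \<forall>t\<in>J. s < t \<longrightarrow> F s \<subset> F t)"

definition filtration_boundary :: "real set \<Rightarrow> (real \<Rightarrow> 'a set) \<Rightarrow> real \<Rightarrow> 'a set" where
  "filtration_boundary J F t = F t - (\<Union>s\<in>{s\<in>J. s < t}. F s)"

text \<open>
  For a member of \<open>class_A\<close> the function \<open>quot f\<close> is continuous on the disk, so on each compact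
  circle \<open>sphere 0 r\<close> with \<open>0 \<le> r < 1\<close> the infimum below is a minimum.
\<close>

definition circle_min :: "complex \<Rightarrow> real \<Rightarrow> (complex \<Rightarrow> complex) \<Rightarrow> real" where
  "circle_min c r f = (INF z\<in>sphere 0 r. Re (c * quot f z))"

definition totally_extremal ::
    "(complex \<Rightarrow> complex) set \<Rightarrow> (complex \<Rightarrow> complex) \<Rightarrow> bool" where
  "totally_extremal F f' \<longleftrightarrow> F \<subseteq> class_A \<and> f' \<in> F \<and>
     (\<forall>c. \<forall>r\<in>{0..<1}. \<forall>f\<in>F. circle_min c r f \<ge> circle_min c r f')"

definition admits_totally_extremal_net ::
    "real set \<Rightarrow> (real \<Rightarrow> (complex \<Rightarrow> complex) set) \<Rightarrow> bool" where
  "admits_totally_extremal_net J F \<longleftrightarrow> (\<exists>f. \<forall>s\<in>J. totally_extremal (F s) (f s))"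

end

theory Submission
  imports Defs
begin

text \<open>
  Put \<open>b = 1 - \<alpha>\<close> and \<open>q z = f z / z\<close>. The condition on \<open>f\<close> reads \<open>Re (q z + b z q' z) \<ge> 1 - \<lambda>\<close>, and
  the radial average \<open>T h z = \<integral>\<^sub>0\<^sup>1 h (t\<^sup>b z) dt\<close> inverts the operator \<open>q \<mapsto> q + b z q'\<close>. By the Schwarz
  integral formula, functions with non-negative real part are averages of rotations of
  \<open>(1 - z) / (1 + z)\<close>; hence \<open>q\<^sub>0 = 1 - \<lambda> + \<lambda> T ((1 - z) / (1 + z))\<close> gives a totally extremal function,
  and \<open>Re q \<ge> 1 - \<lambda> + \<lambda> \<kappa>(\<alpha>)\<close>.

  For \<open>\<alpha> < \<alpha>'\<close> the functional of the class at \<open>\<alpha>'\<close> is a convex combination of the one at \<open>\<alpha>\<close> and \<open>q\<close>.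
  So the inclusion of the classes follows from \<open>\<lambda> (1 - (\<alpha>' - \<alpha>) \<chi>(\<alpha>)) \<le> \<lambda>'\<close>, while letting \<open>z\<close> tend to
  \<open>1\<close> shows that the extremal function at \<open>\<alpha>'\<close> lies outside the class at \<open>\<alpha>\<close> if
  \<open>\<lambda> < \<lambda>' (1 + (\<alpha>' - \<alpha>) \<chi>(\<alpha>'))\<close>. Given \<open>\<lambda> \<chi>(\<alpha>) \<le> \<lambda>' \<chi>(\<alpha>')\<close>, both follow from the strict monotonicity
  of \<open>\<alpha> + 1 / \<chi>(\<alpha>)\<close>, which is an instance of Chebyshev's inequality.
\<close>

subsection \<open>Monotonicity of the constants\<close>

text \<open>For \<open>0 < b\<close> and \<open>0 \<le> t < 1\<close> this is the minimum of the
  real part of \<open>(1 - z) / (1 + z)\<close> on the circle of radius \<open>t powr b\<close>,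
  which is how it enters the bounds on the classes.\<close>

definition cay :: "real \<Rightarrow> real \<Rightarrow> real" where
  "cay b t = (1 - t powr b) / (1 + t powr b)"

lemma one_plus_powr_pos: "0 < 1 + (t::real) powr b"
  by (simp add: add_pos_nonneg)

lemma continuous_on_powr_const: "0 < b \<Longrightarrow> continuous_on {0..1} (\<lambda>t::real. t powr b)"
  by (intro continuous_on_powr') auto

lemma continuous_on_cay: "0 < b \<Longrightarrow> continuous_on {0..1} (cay b)"
  unfolding cay_def[abs_def]
  by (intro continuous_intros continuous_on_powr_const) (auto simp: one_plus_powr_pos less_imp_neq[symmetric])

lemma cay_strict_bounds:
  assumes "0 < b" "0 < t" "t < 1"
  shows "0 < cay b t" "cay b t < 1"
proof -
  have "0 < t powr b" "t powr b < 1"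
    using assms powr_less_mono2[of b t 1] by auto
  then show "0 < cay b t" "cay b t < 1" using one_plus_powr_pos[of t b] by (simp_all add: cay_def)
qed

lemma cay_bounds:
  assumes "0 < b" "0 \<le> t" "t \<le> 1"
  shows "0 \<le> cay b t" "cay b t \<le> 1"
proof -
  have "0 \<le> t powr b" "t powr b \<le> 1"
    using assms powr_mono2[of b t 1] by auto
  then show "0 \<le> cay b t" "cay b t \<le> 1" using one_plus_powr_pos[of t b] by (simp_all add: cay_def)
qed

lemma cay_antimono:
  assumes "0 < b" "0 \<le> s" "s \<le> t"
  shows "cay b t \<le> cay b s"
proof -
  have "s powr b \<le> t powr b" "0 \<le> s powr b" using assms powr_mono2[of b s t] by auto
  then show ?thesis by (simp add: cay_def divide_simps one_plus_powr_pos) argo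
qed

lemma varkappa_eq_integral_cay: "varkappa \<alpha> = integral {0..1} (cay (1 - \<alpha>))"
  by (simp add: varkappa_def cay_def[abs_def])

section \<open>Integrals of \<open>cay\<close> and the value of \<open>chi2\<close> at 1\<close>

lemma integral_pos_continuous:
  fixes f :: "real \<Rightarrow> real"
  assumes "continuous_on {0..1} f" "\<And>x. x \<in> {0<..<1} \<Longrightarrow> 0 \<le> f x" "x \<in> {0..1}" "f x \<noteq> 0"
  shows "0 < integral {0..1} f"
proof -
  have int: "f integrable_on {0..1}" using assms(1) by (rule integrable_continuous_real)
  have "0 \<le> integral {0<..<1} f"
    using assms(2) int by (intro integral_nonneg) (auto simp: integrable_on_open_interval_real)
  then have "0 \<le> integral {0..1} f" by (simp add: integral_open_interval_real)
  \<comment> \<open>A continuous function, nonnegative inside the interval and of integral 0,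
    vanishes on the closed interval. So the nonzero value may sit at an endpoint.\<close>
  moreover have "integral {0..1} f \<noteq> 0"
    using has_integral_0_cbox_imp_0[of 0 1 f x] assms int
    by (auto simp: has_integral_integral)
  ultimately show ?thesis by simp
qed

text \<open>Integration by parts, using \<open>2 x g' x = g x ^ 2 - 1\<close> for \<open>g x = (1 - x) / (1 + x)\<close>.\<close>

lemma integral_cay_by_parts:
  assumes "0 < b"
  shows "integral {0..1} (cay b) = b / 2 * integral {0..1} (\<lambda>t. 1 - (cay b t)\<^sup>2)"
proof -
  have "((\<lambda>t. cay b t - b / 2 * (1 - (cay b t)\<^sup>2)) has_integral
      (1 * cay b 1 - 0 * cay b 0)) {0..1}"
  proof (rule fundamental_theorem_of_calculus_interior)
    show "continuous_on {0..1} (\<lambda>t. t * cay b t)"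
      by (intro continuous_intros continuous_on_cay assms)
    fix t :: real assume t: "t \<in> {0<..<1}"
    have pos: "1 + t powr b > 0" by (rule one_plus_powr_pos)
    have "((\<lambda>t. t * cay b t) has_field_derivative
        cay b t - b / 2 * (1 - (cay b t)\<^sup>2)) (at t)"
      unfolding cay_def[abs_def] using t pos
      apply (auto intro!: derivative_eq_intros)
       apply (simp add: powr_diff)
      apply (simp add: divide_simps power2_eq_square)
      apply (simp add: algebra_simps)
      done
    then show "((\<lambda>t. t * cay b t) has_vector_derivative
        cay b t - b / 2 * (1 - (cay b t)\<^sup>2)) (at t)"
      by (simp add: has_real_derivative_iff_has_vector_derivative)
  qed simp
  then have "integral {0..1} (\<lambda>t. cay b t - b / 2 * (1 - (cay b t)\<^sup>2)) = 0"
    by (simp add: cay_def integral_unique)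
  moreover have "integral {0..1} (\<lambda>t. cay b t - b / 2 * (1 - (cay b t)\<^sup>2)) =
      integral {0..1} (cay b) - integral {0..1} (\<lambda>t. b / 2 * (1 - (cay b t)\<^sup>2))"
    by (intro integral_diff integrable_continuous_real continuous_intros continuous_on_cay assms)
  ultimately show ?thesis by simp
qed

lemma chi2_eq_integral:
  assumes "\<alpha> < 1"
  shows "chi2 \<alpha> = integral {0..1} (\<lambda>t. 1 - (cay (1 - \<alpha>) t)\<^sup>2) / 2"
  using assms integral_cay_by_parts[of "1 - \<alpha>"]
  by (simp add: chi2_def varkappa_eq_integral_cay)

lemma integral_const_minus_cay_power:
  assumes "0 < b"
  shows "integral {0..1} (\<lambda>t. 1 - (cay b t) ^ n) = 1 - integral {0..1} (\<lambda>t. (cay b t) ^ n)"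
  using assms
  by (subst integral_diff) (auto intro!: integrable_continuous_real continuous_intros continuous_on_cay)

text \<open>Inside the interval \<open>cay\<close> lies strictly between 0 and 1, hence exceeds its
  square. The gap controls \<open>chi2\<close> near 1 and makes the constant \<open>m\<close> in the
  Chebyshev argument positive.\<close>

lemma integral_cay_square_less:
  assumes "0 < b"
  shows "integral {0..1} (\<lambda>t. (cay b t)\<^sup>2) < integral {0..1} (cay b)"
proof -
  have "0 < integral {0..1} (\<lambda>t. cay b t - (cay b t)\<^sup>2)"
  proof (rule integral_pos_continuous[of _ "1/2"])
    show "cay b (1/2) - (cay b (1/2))\<^sup>2 \<noteq> 0"
      using cay_strict_bounds[OF assms, of "1/2"] by (simp add: power2_eq_square)
    fix t :: real assume "t \<in> {0<..<1}"
    then have "0 \<le> cay b t * (1 - cay b t)"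
      using cay_strict_bounds[OF assms, of t] by simp
    then show "0 \<le> cay b t - (cay b t)\<^sup>2" by (simp add: power2_eq_square algebra_simps)
  qed (auto intro!: continuous_intros continuous_on_cay assms)
  also have "\<dots> = integral {0..1} (cay b) - integral {0..1} (\<lambda>t. (cay b t)\<^sup>2)"
    by (intro integral_diff integrable_continuous_real continuous_intros continuous_on_cay assms)
  finally show ?thesis by simp
qed

lemma integral_cay_bounds:
  assumes "0 < b"
  shows "0 < integral {0..1} (cay b)" "integral {0..1} (cay b) < 1"
proof -
  show "0 < integral {0..1} (cay b)"
    using cay_strict_bounds[OF assms, of "1/2"]
    by (intro integral_pos_continuous[of _ "1/2"])
      (auto intro!: continuous_on_cay assms cay_bounds)
  have "0 < integral {0..1} (\<lambda>t. 1 - cay b t)"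
    using cay_strict_bounds[OF assms, of "1/2"]
    by (intro integral_pos_continuous[of _ "1/2"])
      (auto intro!: continuous_intros continuous_on_cay assms cay_bounds)
  then show "integral {0..1} (cay b) < 1"
    using integral_const_minus_cay_power[OF assms, of 1] by simp
qed

lemma chi2_one: "chi2 1 = 1 / 2"
proof -
  \<comment> \<open>Integration by parts writes the quotient as \<open>(1 - S) / 2\<close>, and
    \<open>0 \<le> S \<le> varkappa x \<le> (1 - x) / 2\<close>; so \<open>S\<close> tends to 0 and
    the quotient is squeezed to 1/2.\<close>
  have bounds: "1 / 2 - (1 - x) / 4 \<le> varkappa x / (1 - x) \<and> varkappa x / (1 - x) \<le> 1 / 2"
    if "x < 1" for x
  proof -
    define S where "S = integral {0..1} (\<lambda>t. (cay (1 - x) t)\<^sup>2)"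
    have b: "0 < 1 - x" using that by simp
    have eq: "varkappa x / (1 - x) = (1 - S) / 2"
      using chi2_eq_integral[OF that] integral_const_minus_cay_power[OF b, of 2] that
      by (simp add: S_def chi2_def)
    have "0 \<le> S"
      unfolding S_def using b
      by (intro integral_nonneg integrable_continuous_real continuous_intros continuous_on_cay) auto
    moreover have "S \<le> varkappa x"
      using integral_cay_square_less[OF b] by (simp add: S_def varkappa_eq_integral_cay)
    moreover have "varkappa x = (1 - x) * ((1 - S) / 2)"
      using eq b by (simp add: field_simps)
    moreover have "(1 - x) * ((1 - S) / 2) \<le> (1 - x) / 2"
      using b \<open>0 \<le> S\<close> mult_left_mono[of "(1 - S) / 2" "1 / 2" "1 - x"] by simp
    ultimately show ?thesis unfolding eq by auto
  qed
  have ev: "\<forall>\<^sub>F x::real in at_left 1. x < 1"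
    by (simp add: eventually_at_filter)
  have "((\<lambda>x. varkappa x / (1 - x)) \<longlongrightarrow> 1 / 2) (at_left 1)"
  proof (rule tendsto_sandwich)
    show "\<forall>\<^sub>F x in at_left 1. 1 / 2 - (1 - x) / 4 \<le> varkappa x / (1 - x)"
      using ev by eventually_elim (use bounds in blast)
    show "\<forall>\<^sub>F x in at_left 1. varkappa x / (1 - x) \<le> 1 / 2"
      using ev by eventually_elim (use bounds in blast)
    have "((\<lambda>x::real. 1 / 2 - (1 - x) / 4) \<longlongrightarrow> 1 / 2 - (1 - 1) / 4) (at_left 1)"
      by (intro tendsto_intros) simp
    then show "((\<lambda>x::real. 1 / 2 - (1 - x) / 4) \<longlongrightarrow> 1 / 2) (at_left 1)" by simp
  qed simp
  then show ?thesis
    by (simp add: chi2_def tendsto_Lim)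
qed

lemma chi2_pos: "\<alpha> \<le> 1 \<Longrightarrow> 0 < chi2 \<alpha>"
proof (cases "\<alpha> = 1")
  case False
  assume "\<alpha> \<le> 1"
  with False show ?thesis
    using integral_cay_bounds(1)[of "1 - \<alpha>"] by (simp add: chi2_def varkappa_eq_integral_cay)
qed (simp add: chi2_one)

section \<open>Chebyshev comparison of two exponents\<close>

lemma exists_cay_eq:
  assumes "0 < b" "0 < m" "m < 1"
  obtains t where "0 < t" "t < 1" "cay b t = m"
proof
  \<comment> \<open>The map x \<mapsto> (1 - x) / (1 + x) is an involution, so
    \<open>t powr b\<close> has to be \<open>(1 - m) / (1 + m)\<close>.\<close>
  define t where "t = ((1 - m) / (1 + m)) powr (1 / b)"
  have x: "0 < (1 - m) / (1 + m)" "(1 - m) / (1 + m) < 1" using assms by auto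
  show "0 < t" using x assms by (simp add: t_def)
  show "t < 1" using x assms powr_less_mono2[of "1 / b" "(1 - m) / (1 + m)" 1] by (simp add: t_def)
  have "t powr b = (1 - m) / (1 + m)" using x assms by (simp add: t_def powr_powr)
  then have "t powr b * (1 + m) = 1 - m" using assms by (simp add: field_simps)
  then show "cay b t = m" using one_plus_powr_pos[of t b] by (simp add: cay_def field_simps)
qed

text \<open>Chebyshev's inequality: after the substitution \<open>s = t powr (b / b')\<close> the two weighted means of
  \<open>cay\<close> differ by the increasing weight \<open>t powr (b / b' - 1)\<close>.\<close>

lemma cay_mean_less:
  assumes "0 < b'" "b' < b" and "0 < m" "m < 1"
    and mean: "integral {0..1} (\<lambda>t. (cay b t - m) * (1 - cay b t)) = 0"
  shows "integral {0..1} (\<lambda>t. (cay b' t - m) * (1 - cay b' t)) < 0"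
proof -
  define \<kappa> where "\<kappa> = b / b'"
  have \<kappa>: "1 < \<kappa>" "\<kappa> * b' = b" using assms by (auto simp: \<kappa>_def)
  have b: "0 < b" using assms by simp
  define F where "F = (\<lambda>c t. (cay c t - m) * (1 - cay c t))"
  have contF: "continuous_on {0..1} (F c)" if "0 < c" for c
    unfolding F_def by (intro continuous_intros continuous_on_cay that)
  have sub: "((\<lambda>t. (\<kappa> * t powr (\<kappa> - 1)) *\<^sub>R F b' (t powr \<kappa>)) has_integral
      integral {0 powr \<kappa>..1 powr \<kappa>} (F b')) {0..1}"
  proof (rule has_integral_substitution_strong[of "{0}" 0 1 "\<lambda>t. t powr \<kappa>" 0 1])
    show "(\<lambda>t. t powr \<kappa>) ` {0..1} \<subseteq> {0..1}"
      using \<kappa> powr_mono2[of \<kappa> _ 1] by auto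
    show "continuous_on {0..1} (F b')" using assms by (intro contF)
    show "continuous_on {0..1} (\<lambda>t. t powr \<kappa>)" using \<kappa> by (intro continuous_on_powr_const) auto
    fix t :: real assume "t \<in> {0..1} - {0}"
    then show "((\<lambda>t. t powr \<kappa>) has_real_derivative \<kappa> * t powr (\<kappa> - 1)) (at t within {0..1})"
      by (auto intro!: has_field_derivative_at_within has_real_derivative_powr)
  qed auto
  have cay_pow: "cay b' (t powr \<kappa>) = cay b t" for t
    using \<kappa> by (simp add: cay_def powr_powr)
  have "F b' (t powr \<kappa>) = F b t" for t
    by (simp add: F_def cay_pow)
  then have sub': "((\<lambda>t. \<kappa> * t powr (\<kappa> - 1) * F b t) has_integral integral {0..1} (F b')) {0..1}"
    using sub by simp
  obtain t0 where t0: "0 < t0" "t0 < 1" "cay b t0 = m"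
    using exists_cay_eq[OF b \<open>0 < m\<close> \<open>m < 1\<close>] .
  \<comment> \<open>Shifting the weight by its value at \<open>t0\<close> costs nothing, as
    \<open>F b\<close> has mean 0. Now \<open>w\<close> is nonnegative before \<open>t0\<close> and
    nonpositive after it, just as \<open>F b\<close> is, so the product never gets negative.\<close>
  define w where "w = (\<lambda>t. \<kappa> * t0 powr (\<kappa> - 1) - \<kappa> * t powr (\<kappa> - 1))"
  have contw: "continuous_on {0..1} w"
    unfolding w_def using \<kappa> by (intro continuous_intros continuous_on_powr_const) auto
  have nonneg: "0 \<le> w t * F b t" if "t \<in> {0..1}" for t
  proof -
    have one: "0 \<le> 1 - cay b t" using cay_bounds[OF b, of t] that by simp
    show ?thesis
    proof (cases "t \<le> t0")
      case True
      have "t powr (\<kappa> - 1) \<le> t0 powr (\<kappa> - 1)" using True that \<kappa> by (intro powr_mono2) auto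
      then have "0 \<le> w t" using \<kappa> by (simp add: w_def)
      moreover have "0 \<le> cay b t - m" using cay_antimono[OF b, of t t0] True that t0 by simp
      ultimately show ?thesis using one by (simp add: F_def)
    next
      case False
      have "t0 powr (\<kappa> - 1) \<le> t powr (\<kappa> - 1)" using False t0 \<kappa> by (intro powr_mono2) auto
      then have "w t \<le> 0" using \<kappa> by (simp add: w_def)
      moreover have "cay b t - m \<le> 0" using cay_antimono[OF b, of t0 t] False t0 by simp
      ultimately show ?thesis using one
        by (simp add: F_def mult_nonpos_nonpos mult_nonpos_nonneg)
    qed
  qed
  have "0 < integral {0..1} (\<lambda>t. w t * F b t)"
  \<comment> \<open>Strictness is read off at 1, where \<open>cay\<close> vanishes and both factors
    are negative.\<close>
  proof (rule integral_pos_continuous[of _ 1])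
    have "1 > t0 powr (\<kappa> - 1)"
      using t0 \<kappa> powr_less_mono2[of "\<kappa> - 1" t0 1] by simp
    then have "w 1 < 0" using \<kappa> by (simp add: w_def)
    moreover have "F b 1 < 0" using \<open>0 < m\<close> by (simp add: F_def cay_def)
    ultimately show "w 1 * F b 1 \<noteq> 0" by simp
  qed (auto intro!: continuous_intros contw contF b nonneg)
  also have "integral {0..1} (\<lambda>t. w t * F b t) =
      integral {0..1} (\<lambda>t. \<kappa> * t0 powr (\<kappa> - 1) * F b t - \<kappa> * t powr (\<kappa> - 1) * F b t)"
    by (simp add: w_def algebra_simps)
  also have "\<dots> = integral {0..1} (\<lambda>t. \<kappa> * t0 powr (\<kappa> - 1) * F b t)
      - integral {0..1} (\<lambda>t. \<kappa> * t powr (\<kappa> - 1) * F b t)"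
    by (intro integral_diff integrable_continuous_real continuous_intros contF b
        has_integral_integrable[OF sub'])
  also have "integral {0..1} (\<lambda>t. \<kappa> * t0 powr (\<kappa> - 1) * F b t) = 0"
    using mean by (simp add: F_def)
  also have "integral {0..1} (\<lambda>t. \<kappa> * t powr (\<kappa> - 1) * F b t) = integral {0..1} (F b')"
    using sub' by (rule integral_unique)
  finally show ?thesis by (simp add: F_def)
qed

text \<open>By (x - m) (1 - x) = (1 - x^2) - (1 + m) (1 - x), the sign of this mean compares the
  ratio of the integrals of \<open>1 - cay^2\<close> and \<open>1 - cay\<close> with
  \<open>1 + m\<close>.\<close>

lemma integral_cay_mean_eq:
  assumes "0 < b"
  shows "integral {0..1} (\<lambda>t. (cay b t - m) * (1 - cay b t)) =
    integral {0..1} (\<lambda>t. 1 - (cay b t)\<^sup>2) - (1 + m) * (1 - integral {0..1} (cay b))"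
proof -
  have "(\<lambda>t. (cay b t - m) * (1 - cay b t)) = (\<lambda>t. (1 - (cay b t)\<^sup>2) - (1 + m) * (1 - cay b t))"
    by (auto simp: algebra_simps power2_eq_square)
  moreover have "integral {0..1} (\<lambda>t. (1 - (cay b t)\<^sup>2) - (1 + m) * (1 - cay b t)) =
      integral {0..1} (\<lambda>t. 1 - (cay b t)\<^sup>2) - integral {0..1} (\<lambda>t. (1 + m) * (1 - cay b t))"
    by (intro integral_diff integrable_continuous_real continuous_intros continuous_on_cay assms)
  ultimately show ?thesis
    using integral_const_minus_cay_power[OF assms, of 1] by simp
qed

text \<open>Equivalently, \<open>\<alpha> + 1 / chi2 \<alpha>\<close> is strictly increasing.\<close>

lemma chi2_diff_less:
  assumes "\<alpha> < \<alpha>'" "\<alpha>' \<le> 1"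
  shows "chi2 \<alpha>' - chi2 \<alpha> < (\<alpha>' - \<alpha>) * chi2 \<alpha> * chi2 \<alpha>'"
proof -
  define b where "b = 1 - \<alpha>"
  have b: "0 < b" using assms by (simp add: b_def)
  define A where "A = integral {0..1} (cay b)"
  define S where "S = integral {0..1} (\<lambda>t. 1 - (cay b t)\<^sup>2)"
  have chi: "chi2 \<alpha> = S / 2" using assms chi2_eq_integral[of \<alpha>] by (simp add: S_def b_def)
  have A: "A = b / 2 * S" using integral_cay_by_parts[OF b] by (simp add: A_def S_def)
  have A1: "0 < A" "A < 1" using integral_cay_bounds[OF b] by (auto simp: A_def)
  have AS: "1 - A < S"
    using integral_cay_square_less[OF b] integral_const_minus_cay_power[OF b, of 2]
    by (simp add: A_def S_def)
  show ?thesis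
  proof (cases "\<alpha>' = 1")
    \<comment> \<open>With \<open>chi2 1 = 1 / 2\<close> and \<open>A = b / 2 * S\<close> the claim
      becomes \<open>1 - A < S\<close>.\<close>
    case True
    then show ?thesis using A AS by (simp add: chi chi2_one b_def field_simps)
  next
    case False
    define b' where "b' = 1 - \<alpha>'"
    have b': "0 < b'" "b' < b" using assms False by (auto simp: b_def b'_def)
    define A' where "A' = integral {0..1} (cay b')"
    define S' where "S' = integral {0..1} (\<lambda>t. 1 - (cay b' t)\<^sup>2)"
    have chi': "chi2 \<alpha>' = S' / 2" using assms False chi2_eq_integral[of \<alpha>'] by (simp add: S'_def b'_def)
    have A': "A' = b' / 2 * S'" using integral_cay_by_parts[OF b'(1)] by (simp add: A'_def S'_def)
    \<comment> \<open>This \<open>m\<close> makes the mean for the exponent \<open>b\<close> vanish.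
      It lies in (0, 1): the lower bound is \<open>AS\<close>, the upper one comes from the positive
      integral of \<open>(1 - cay)^2\<close>.\<close>
    define m where "m = S / (1 - A) - 1"
    have m: "S = (1 + m) * (1 - A)" using A1 by (simp add: m_def)
    have "0 < m" using AS A1 by (simp add: m_def)
    have "0 < integral {0..1} (\<lambda>t. (1 - cay b t)\<^sup>2)"
      using cay_strict_bounds[OF b, of "1/2"]
      by (intro integral_pos_continuous[of _ "1/2"])
        (auto intro!: continuous_intros continuous_on_cay b)
    also have "(\<lambda>t. (1 - cay b t)\<^sup>2) = (\<lambda>t. - ((cay b t - 1) * (1 - cay b t)))"
      by (auto simp: power2_eq_square algebra_simps)
    finally have "S < 2 * (1 - A)"
      using integral_cay_mean_eq[OF b, of 1] by (simp add: S_def A_def)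
    then have "m < 1" using A1 by (simp add: m_def field_simps)
    have "integral {0..1} (\<lambda>t. (cay b t - m) * (1 - cay b t)) = 0"
      using integral_cay_mean_eq[OF b, of m] m by (simp add: S_def A_def)
    then have "integral {0..1} (\<lambda>t. (cay b' t - m) * (1 - cay b' t)) < 0"
      by (rule cay_mean_less[OF b' \<open>0 < m\<close> \<open>m < 1\<close>])
    then have "S' < (1 + m) * (1 - A')"
      using integral_cay_mean_eq[OF b'(1), of m] by (simp add: S'_def A'_def)
    then have "S' * (1 - A) < (1 + m) * (1 - A') * (1 - A)"
      using A1 by simp
    also have "\<dots> = S * (1 - A')" by (simp add: m algebra_simps)
    finally have "S' - S < S' * A - S * A'" by (simp add: algebra_simps)
    \<comment> \<open>The by-parts identities for \<open>A\<close> and \<open>A'\<close> create the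
      factor \<open>b - b' = \<alpha>' - \<alpha>\<close>.\<close>
    also have "\<dots> = (b - b') * S * S' / 2" by (simp add: A A' algebra_simps)
    finally show ?thesis by (simp add: chi chi' b_def b'_def)
  qed
qed

subsection \<open>Radial averages and the Schwarz integral formula\<close>

text \<open>The case split is needed since \<open>0 powr 0 = 0\<close>.\<close>

definition dilation :: "real \<Rightarrow> real \<Rightarrow> real" where
  "dilation b t = (if b = 0 then 1 else t powr b)"

definition radial_avg :: "real \<Rightarrow> (complex \<Rightarrow> complex) \<Rightarrow> complex \<Rightarrow> complex" where
  "radial_avg b h z = integral {0..1} (\<lambda>t. h (complex_of_real (dilation b t) * z))"

definition cayley :: "complex \<Rightarrow> complex" where
  "cayley z = (1 - z) / (1 + z)"

section \<open>Dilations and the inversion of the operator \<open>q + b z q'\<close>\<close>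

lemma dilation_bounds: "0 \<le> b \<Longrightarrow> 0 \<le> t \<Longrightarrow> t \<le> 1 \<Longrightarrow> 0 \<le> dilation b t \<and> dilation b t \<le> 1"
  using powr_mono2[of b t 1] by (auto simp: dilation_def)

lemma continuous_on_dilation: "0 \<le> b \<Longrightarrow> continuous_on {0..1} (dilation b)"
  unfolding dilation_def[abs_def]
  by (cases "b = 0"; simp; intro continuous_on_powr'; auto)

lemma norm_dilation_mult_le:
  assumes "0 \<le> b" "t \<in> {0..1}"
  shows "norm (complex_of_real (dilation b t) * z) \<le> norm z"
  using dilation_bounds[of b t] assms by (simp add: norm_mult mult_left_le_one_le)

lemma dilation_mult_in_ball:
  assumes "0 \<le> b" "t \<in> {0..1}" "z \<in> ball 0 1"
  shows "complex_of_real (dilation b t) * z \<in> ball 0 1"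
  using norm_dilation_mult_le[OF assms(1,2), of z] assms(3) by simp

lemma continuous_on_dilation_compose:
  assumes "0 \<le> b" "continuous_on (ball 0 1) h" "z \<in> ball 0 1"
  shows "continuous_on {0..1} (\<lambda>t. h (complex_of_real (dilation b t) * z))"
proof (rule continuous_on_compose2[OF assms(2)])
  show "continuous_on {0..1} (\<lambda>t. complex_of_real (dilation b t) * z)"
    by (intro continuous_intros continuous_on_dilation assms)
qed (use dilation_mult_in_ball[OF assms(1) _ assms(3)] in auto)

text \<open>With w = t^b z, the integrand is the t-derivative of t h(w), whose boundary values are 0
  and h(z). For b = 0 it is constant.\<close>

lemma has_integral_dilation_ode:
  assumes b: "0 \<le> b" and h: "h holomorphic_on ball 0 1" and z: "z \<in> ball 0 1"
  shows "((\<lambda>t. h (of_real (dilation b t) * z)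
      + of_real b * (of_real (dilation b t) * z) * deriv h (of_real (dilation b t) * z))
      has_integral h z) {0..1}"
proof (cases "b = 0")
  case True
  then show ?thesis using has_integral_const_real[of "h z" 0 1] by (simp add: dilation_def)
next
  case False
  then have b0: "0 < b" using b by simp
  define w where "w = (\<lambda>t. complex_of_real (dilation b t) * z)"
  have w: "w t \<in> ball 0 1" if "t \<in> {0..1}" for t
    unfolding w_def using b that z by (rule dilation_mult_in_ball)
  have "((\<lambda>t. h (w t) + of_real b * w t * deriv h (w t)) has_integral
      (complex_of_real 1 * h (w 1) - complex_of_real 0 * h (w 0))) {0..1}"
  \<comment> \<open>For \<open>b < 1\<close> the derivative of \<open>t powr b\<close> blows up at
    0; therefore derivatives are taken in the open interval only, together with continuity up to the
    ends.\<close>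
  proof (rule fundamental_theorem_of_calculus_interior)
    show "continuous_on {0..1} (\<lambda>t. complex_of_real t * h (w t))"
      unfolding w_def using h
      by (intro continuous_intros continuous_on_dilation_compose b z holomorphic_on_imp_continuous_on)
    fix t :: real assume t: "t \<in> {0<..<1}"
    have wd: "(w has_vector_derivative of_real (b * t powr (b - 1)) * z) (at t)"
    proof -
      have "((\<lambda>t. t powr b) has_field_derivative b * t powr (b - 1)) (at t)"
        using t has_real_derivative_powr[of t b] by simp
      then have "((\<lambda>t. complex_of_real (t powr b)) has_vector_derivative of_real (b * t powr (b - 1))) (at t)"
        by (rule has_vector_derivative_of_real)
      then have "((\<lambda>t. complex_of_real (t powr b) * z) has_vector_derivative of_real (b * t powr (b - 1)) * z) (at t)"
        by (rule has_vector_derivative_mult_left)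
      then show ?thesis using False by (simp add: w_def dilation_def)
    qed
    have "(h has_field_derivative deriv h (w t)) (at (w t))"
      using h w[of t] t by (intro holomorphic_derivI[of h "ball 0 1"]) auto
    then have hd: "((\<lambda>t. h (w t)) has_vector_derivative
        (of_real (b * t powr (b - 1)) * z) * deriv h (w t)) (at t)"
      using field_vector_diff_chain_at[OF wd] by (simp add: o_def)
    have td: "(complex_of_real has_vector_derivative of_real 1) (at t)"
      by (rule has_vector_derivative_of_real) simp
    have "((\<lambda>t. complex_of_real t * h (w t)) has_vector_derivative
        complex_of_real t * ((of_real (b * t powr (b - 1)) * z) * deriv h (w t))
         + of_real 1 * h (w t)) (at t)"
      by (rule has_vector_derivative_mult[OF td hd])
    moreover have "t * (b * t powr (b - 1)) = b * t powr b"
      using t by (simp add: powr_diff)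
    then have "complex_of_real t * (of_real (b * t powr (b - 1)) * z) = of_real b * w t"
      using False by (simp add: w_def dilation_def flip: of_real_mult mult.assoc)
    then have "complex_of_real t * ((of_real (b * t powr (b - 1)) * z) * deriv h (w t)) + of_real 1 * h (w t)
        = h (w t) + of_real b * w t * deriv h (w t)"
      by (simp flip: mult.assoc)
    ultimately show "((\<lambda>t. complex_of_real t * h (w t)) has_vector_derivative
        h (w t) + of_real b * w t * deriv h (w t)) (at t)"
      by (simp only:)
  qed simp
  then show ?thesis using False by (simp add: w_def dilation_def)
qed

lemma radial_avg_ode_inverse:
  assumes "0 \<le> b" "q holomorphic_on ball 0 1" "z \<in> ball 0 1"
  shows "radial_avg b (\<lambda>z. q z + of_real b * z * deriv q z) z = q z"
  unfolding radial_avg_def using has_integral_dilation_ode[OF assms] by (rule integral_unique)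

lemma radial_avg_has_field_derivative:
  assumes b: "0 \<le> b" and h: "h holomorphic_on ball 0 1" and z: "z \<in> ball 0 1"
  shows "(radial_avg b h has_field_derivative
    integral {0..1} (\<lambda>t. of_real (dilation b t) * deriv h (of_real (dilation b t) * z))) (at z)"
proof -
  have dh: "deriv h holomorphic_on ball 0 1" using h by (intro holomorphic_deriv) auto
  have "((\<lambda>x. integral (cbox 0 1) (\<lambda>t. h (of_real (dilation b t) * x))) has_field_derivative
      integral (cbox 0 1) (\<lambda>t. of_real (dilation b t) * deriv h (of_real (dilation b t) * z)))
      (at z within ball 0 1)"
  proof (rule leibniz_rule_field_derivative)
    fix x t assume "x \<in> ball (0::complex) 1" "t \<in> cbox (0::real) 1"
    then have "(h has_field_derivative deriv h (of_real (dilation b t) * x)) (at (of_real (dilation b t) * x))"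
      using h dilation_mult_in_ball[OF b, of t x]
      by (intro holomorphic_derivI[of h "ball 0 1"]) auto
    then have "((\<lambda>x. h (of_real (dilation b t) * x)) has_field_derivative
        deriv h (of_real (dilation b t) * x) * of_real (dilation b t)) (at x within ball 0 1)"
      by (intro DERIV_chain2[of h]) (auto intro!: derivative_eq_intros)
    then show "((\<lambda>x. h (of_real (dilation b t) * x)) has_field_derivative
        of_real (dilation b t) * deriv h (of_real (dilation b t) * x)) (at x within ball 0 1)"
      by (simp add: mult.commute)
  next
    fix x assume "x \<in> ball (0::complex) 1"
    then show "(\<lambda>t. h (of_real (dilation b t) * x)) integrable_on cbox 0 1"
      using h b by (simp add: integrable_continuous_real continuous_on_dilation_compose
          holomorphic_on_imp_continuous_on)
  next
    have c: "continuous_on (ball (0::complex) 1 \<times> {0..1}) (\<lambda>p. complex_of_real (dilation b (snd p)))"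
      by (intro continuous_intros continuous_on_compose2[OF continuous_on_dilation[OF b]]) auto
    have "continuous_on (ball (0::complex) 1 \<times> {0..1})
        (\<lambda>p. deriv h (complex_of_real (dilation b (snd p)) * fst p))"
      by (rule continuous_on_compose2[OF holomorphic_on_imp_continuous_on[OF dh]])
        (use dilation_mult_in_ball[OF b] in \<open>auto intro!: continuous_intros c simp del: mem_ball\<close>)
    then show "continuous_on (ball 0 1 \<times> cbox 0 1)
        (\<lambda>(x, t). of_real (dilation b t) * deriv h (of_real (dilation b t) * x))"
      using c by (auto simp: split_beta intro!: continuous_intros)
  qed (use z in auto)
  then show ?thesis
    using z at_within_open[of z "ball 0 1"] by (simp add: radial_avg_def[abs_def])
qed

lemma radial_avg_holomorphic:
  assumes "0 \<le> b" "h holomorphic_on ball 0 1"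
  shows "radial_avg b h holomorphic_on ball 0 1"
  using radial_avg_has_field_derivative[OF assms] holomorphic_on_open[OF open_ball] by blast

text \<open>Differentiation under the integral sign turns the left-hand side into the integral of
  \<open>has_integral_dilation_ode\<close>. Together with \<open>radial_avg_ode_inverse\<close> this
  makes the average a two-sided inverse.\<close>

lemma radial_avg_ode:
  assumes b: "0 \<le> b" and h: "h holomorphic_on ball 0 1" and z: "z \<in> ball 0 1"
  shows "radial_avg b h z + of_real b * z * deriv (radial_avg b h) z = h z"
proof -
  define w where "w = (\<lambda>t. complex_of_real (dilation b t) * z)"
  have dh: "deriv h holomorphic_on ball 0 1" using h by (intro holomorphic_deriv) auto
  have int: "(\<lambda>t. h (w t)) integrable_on {0..1}" "(\<lambda>t. of_real (dilation b t) * deriv h (w t)) integrable_on {0..1}"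
    unfolding w_def using h dh
    by (auto intro!: integrable_continuous_real continuous_intros continuous_on_dilation
        continuous_on_dilation_compose b z holomorphic_on_imp_continuous_on simp del: mem_ball)
  have "h z = integral {0..1} (\<lambda>t. h (w t) + of_real b * w t * deriv h (w t))"
    unfolding w_def using has_integral_dilation_ode[OF assms] by (rule integral_unique[symmetric])
  also have "\<dots> = integral {0..1} (\<lambda>t. h (w t) + (of_real b * z) * (of_real (dilation b t) * deriv h (w t)))"
    by (simp add: w_def mult_ac)
  also have "\<dots> = integral {0..1} (\<lambda>t. h (w t)) +
      integral {0..1} (\<lambda>t. (of_real b * z) * (of_real (dilation b t) * deriv h (w t)))"
    using int by (intro integral_add integrable_on_mult_right)
  also have "\<dots> = radial_avg b h z + of_real b * z * deriv (radial_avg b h) z"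
    using DERIV_imp_deriv[OF radial_avg_has_field_derivative[OF assms]]
    by (simp add: radial_avg_def w_def)
  finally show ?thesis by simp
qed

section \<open>The Cayley transform and integral formulas on the unit circle\<close>

lemma cayley_holomorphic: "cayley holomorphic_on ball 0 1"
proof -
  have "1 + z \<noteq> 0" if "z \<in> ball 0 1" for z :: complex
  proof
    assume "1 + z = 0"
    then have "z = - 1" by (simp add: add_eq_0_iff)
    then show False using that by simp
  qed
  then show ?thesis unfolding cayley_def[abs_def] by (intro holomorphic_intros) auto
qed

text \<open>The real part is (1 - |z|^2) / |1 + z|^2. Bounding |1 + z| by 1 + |z| leaves (1 - |z|) /
  (1 + |z|), which decreases in |z|.\<close>

lemma Re_cayley_ge:
  assumes "norm z \<le> r" "r < 1"
  shows "(1 - r) / (1 + r) \<le> Re (cayley z)"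
proof -
  have r: "0 \<le> r" using assms(1) norm_ge_zero[of z] by linarith
  have ne: "1 + z \<noteq> 0"
  proof
    assume "1 + z = 0"
    then have "z = - 1" by (simp add: add_eq_0_iff)
    then show False using assms by simp
  qed
  have "norm (1 + z) \<le> 1 + norm z" using norm_triangle_ineq[of 1 z] by simp
  then have sq: "(norm (1 + z))\<^sup>2 \<le> (1 + norm z)\<^sup>2" by (intro power_mono) auto
  have "(1 - r) / (1 + r) \<le> (1 - norm z) / (1 + norm z)"
    using assms norm_ge_zero[of z] by (intro frac_le) linarith+
  also have "\<dots> = (1 - (norm z)\<^sup>2) / (1 + norm z)\<^sup>2"
    using norm_ge_zero[of z] by (simp add: divide_simps power2_eq_square add_pos_nonneg) algebra
  also have "\<dots> \<le> (1 - (norm z)\<^sup>2) / (norm (1 + z))\<^sup>2"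
    using sq ne assms r by (intro divide_left_mono) (auto simp: abs_square_le_1 intro!: mult_pos_pos add_pos_nonneg)
  also have "\<dots> = Re (cayley z)"
    unfolding cayley_def Re_divide' unfolding cmod_power2 by (simp add: power2_eq_square algebra_simps)
  finally show ?thesis .
qed

text \<open>Cauchy's formula with u = e^(2 pi i x): the extra factor u comes from du = 2 pi i u
  dx.\<close>

lemma has_integral_unit_circle_Cauchy:
  assumes "G holomorphic_on cball 0 1" "norm w < 1"
  shows "((\<lambda>x. G (cis (2 * pi * x)) * cis (2 * pi * x) / (cis (2 * pi * x) - w)) has_integral G w) {0..1}"
proof -
  have "((\<lambda>u. G u / (u - w)) has_contour_integral (2 * of_real pi * \<i> * G w)) (circlepath 0 1)"
    using assms by (intro Cauchy_integral_circlepath_simple) auto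
  then have "((\<lambda>x. G (circlepath 0 1 x) / (circlepath 0 1 x - w) *
      vector_derivative (circlepath 0 1) (at x within {0..1})) has_integral (2 * of_real pi * \<i> * G w)) {0..1}"
    by (simp add: has_contour_integral_def)
  then have "((\<lambda>x. (2 * of_real pi * \<i>) *
      (G (cis (2 * pi * x)) * cis (2 * pi * x) / (cis (2 * pi * x) - w))) has_integral (2 * of_real pi * \<i> * G w)) {0..1}"
  proof (rule has_integral_eq[rotated])
    fix x :: real assume "x \<in> {0..1}"
    then have "vector_derivative (circlepath 0 1) (at x within {0..1}) = 2 * of_real pi * \<i> * cis (2 * pi * x)"
      by (simp add: vector_derivative_circlepath01 cis_conv_exp mult_ac)
    moreover have "circlepath 0 1 x = cis (2 * pi * x)"
      by (simp add: circlepath cis_conv_exp mult_ac)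
    ultimately show "G (circlepath 0 1 x) / (circlepath 0 1 x - w) *
        vector_derivative (circlepath 0 1) (at x within {0..1}) = (2 * of_real pi * \<i>) *
      (G (cis (2 * pi * x)) * cis (2 * pi * x) / (cis (2 * pi * x) - w))"
      by (simp add: mult_ac)
  qed
  then have "((\<lambda>x. (1 / (2 * of_real pi * \<i>)) * ((2 * of_real pi * \<i>) *
      (G (cis (2 * pi * x)) * cis (2 * pi * x) / (cis (2 * pi * x) - w)))) has_integral
        (1 / (2 * of_real pi * \<i>)) * (2 * of_real pi * \<i> * G w)) {0..1}"
    by (rule has_integral_mult_right)
  then show ?thesis by simp
qed

lemma has_integral_unit_circle_mean:
  assumes "G holomorphic_on cball 0 1"
  shows "((\<lambda>x. G (cis (2 * pi * x))) has_integral G 0) {0..1}"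
  using has_integral_unit_circle_Cauchy[OF assms, of 0] by simp

text \<open>Three integrals are combined: Cauchy's formula for \<open>h\<close>, a conjugated mean
  value that replaces \<open>h\<close> by its conjugate on the circle, and the mean of
  \<open>Re h\<close>. Their kernel is 2u / (u - z) - 1 = (u + z) / (u - z), a rotated Cayley
  transform. As \<open>h 0\<close> is real, the constants cancel.\<close>

lemma Schwarz_integral_formula:
  assumes h: "h holomorphic_on cball 0 1" and real: "Im (h 0) = 0" and z: "norm z < 1"
  shows "((\<lambda>x. of_real (Re (h (cis (2 * pi * x)))) * cayley (- (cis (- (2 * pi * x)) * z))) has_integral h z) {0..1}"
proof -
  define e where "e = (\<lambda>x. cis (2 * pi * x))"
  have ne: "e x \<noteq> z" for x using z by (auto simp: e_def)
  have cz: "1 - u * cnj z \<noteq> 0" if "norm u \<le> 1" for u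
  proof
    assume "1 - u * cnj z = 0"
    then have "norm (u * cnj z) = 1" by simp
    moreover have "norm (u * cnj z) \<le> norm z" using that by (simp add: norm_mult mult_left_le_one_le)
    ultimately show False using z by simp
  qed
  have i1: "((\<lambda>x. h (e x) * e x / (e x - z)) has_integral h z) {0..1}"
    unfolding e_def using h z by (rule has_integral_unit_circle_Cauchy)
  \<comment> \<open>On the unit circle the conjugate of \<open>1 / (1 - u * cnj z)\<close> is
    \<open>u / (u - z)\<close>, so the conjugated mean value of this function has the Cauchy
    kernel.\<close>
  have "(\<lambda>u. h u / (1 - u * cnj z)) holomorphic_on cball 0 1"
    using cz by (intro holomorphic_intros h) auto
  then have "((\<lambda>x. h (e x) / (1 - e x * cnj z)) has_integral h 0) {0..1}"
    unfolding e_def by (rule has_integral_unit_circle_mean[of "\<lambda>u. h u / (1 - u * cnj z)", simplified])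
  then have "((\<lambda>x. cnj (h (e x) / (1 - e x * cnj z))) has_integral cnj (h 0)) {0..1}"
    by (subst has_integral_cnj[unfolded o_def])
  moreover have "cnj (h (e x) / (1 - e x * cnj z)) = cnj (h (e x)) * e x / (e x - z)" for x
  proof -
    have "cnj (e x) * e x = 1" by (simp add: e_def cis_cnj cis_mult)
    moreover have "1 - cnj (e x) * z \<noteq> 0" using cz[of "e x"]
      by (metis complex_cnj_cancel_iff complex_cnj_cnj complex_cnj_diff complex_cnj_mult complex_cnj_one
          complex_cnj_zero e_def norm_cis order_refl)
    ultimately have "1 / (1 - cnj (e x) * z) = e x / (e x - z)"
      using ne[of x] by (simp add: divide_simps) (simp add: algebra_simps)
    then show ?thesis by (simp add: divide_inverse mult_ac)
  qed
  ultimately have i2: "((\<lambda>x. cnj (h (e x)) * e x / (e x - z)) has_integral cnj (h 0)) {0..1}"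
    by simp
  have "((\<lambda>x. h (e x)) has_integral h 0) {0..1}"
    unfolding e_def using h by (rule has_integral_unit_circle_mean)
  then have "((\<lambda>x. Re (h (e x))) has_integral Re (h 0)) {0..1}"
    by (rule has_integral_Re)
  then have i3: "((\<lambda>x. complex_of_real (Re (h (e x)))) has_integral of_real (Re (h 0))) {0..1}"
    by (rule has_integral_of_real)
  have "((\<lambda>x. h (e x) * e x / (e x - z) + cnj (h (e x)) * e x / (e x - z) - of_real (Re (h (e x)))) has_integral
      (h z + cnj (h 0) - of_real (Re (h 0)))) {0..1}"
    by (intro has_integral_diff has_integral_add i1 i2 i3)
  moreover have "h (e x) * e x / (e x - z) + cnj (h (e x)) * e x / (e x - z) - of_real (Re (h (e x)))
      = of_real (Re (h (e x))) * cayley (- (cis (- (2 * pi * x)) * z))" for x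
  proof -
    have "cis (- (2 * pi * x)) = 1 / e x" by (simp add: e_def cis_inverse[symmetric] inverse_eq_divide)
    then have "cayley (- (cis (- (2 * pi * x)) * z)) = (1 + z / e x) / (1 - z / e x)"
      by (simp add: cayley_def)
    also have "\<dots> = (e x + z) / (e x - z)"
      using ne[of x] by (simp add: divide_simps e_def)
    also have "\<dots> = 2 * e x / (e x - z) - 1" using ne[of x] by (simp add: divide_simps)
    finally have c: "cayley (- (cis (- (2 * pi * x)) * z)) = 2 * e x / (e x - z) - 1" .
    have "h (e x) + cnj (h (e x)) = 2 * of_real (Re (h (e x)))"
      by (simp add: complex_add_cnj)
    then have "h (e x) * e x / (e x - z) + cnj (h (e x)) * e x / (e x - z)
        = 2 * of_real (Re (h (e x))) * e x / (e x - z)"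
      by (metis add_divide_distrib distrib_right)
    then show ?thesis unfolding c by (simp add: algebra_simps)
  qed
  moreover have "h z + cnj (h 0) - of_real (Re (h 0)) = h z"
    using real by (simp add: complex_eq_iff)
  ultimately show ?thesis by (simp add: e_def)
qed

section \<open>Sharp lower bounds for radial averages\<close>

lemma radial_avg_bound_closed_disc:
  assumes b: "0 \<le> b" and h: "h holomorphic_on cball 0 1" and real: "Im (h 0) = 0"
    and pos: "\<And>z. norm z = 1 \<Longrightarrow> 0 \<le> Re (h z)" and z: "norm z < 1"
    and m: "\<And>\<zeta>. norm \<zeta> = norm z \<Longrightarrow> m \<le> Re (c * radial_avg b cayley \<zeta>)"
  shows "Re (h 0) * m \<le> Re (c * radial_avg b h z)"
proof -
  define w where "w = (\<lambda>x. - (cis (- (2 * pi * x)) * z))"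
  define R where "R = (\<lambda>x. Re (h (cis (2 * pi * x))))"
  have nw: "norm (w x) = norm z" for x by (simp add: w_def norm_mult)
  have contR: "continuous_on UNIV R"
    unfolding R_def
    by (intro continuous_intros continuous_on_compose2[OF holomorphic_on_imp_continuous_on[OF h]]) auto
  have contw: "continuous_on UNIV w"
    unfolding w_def by (intro continuous_intros)
  have cont: "continuous_on (cbox (0, 0) (1, 1))
      (\<lambda>(t, x). of_real (R x) * cayley (of_real (dilation b t) * w x))"
  proof -
    have c1: "continuous_on ({0..1} \<times> {0..1}) (\<lambda>p::real \<times> real. complex_of_real (dilation b (fst p)))"
      by (intro continuous_intros continuous_on_compose2[OF continuous_on_dilation[OF b]]) auto
    have c2: "continuous_on ({0..1} \<times> {0..1}) (\<lambda>p::real \<times> real. complex_of_real (R (snd p)))"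
      by (intro continuous_intros continuous_on_compose2[OF contR]) auto
    have c3: "continuous_on ({0..1} \<times> {0..1}) (\<lambda>p::real \<times> real. w (snd p))"
      by (intro continuous_intros continuous_on_compose2[OF contw]) auto
    have "continuous_on ({0..1} \<times> {0..1})
        (\<lambda>p::real \<times> real. cayley (of_real (dilation b (fst p)) * w (snd p)))"
      by (rule continuous_on_compose2[OF holomorphic_on_imp_continuous_on[OF cayley_holomorphic]])
        (use dilation_mult_in_ball[OF b, of _ "w _"] nw z in \<open>auto intro!: continuous_intros c1 c3\<close>)
    then show ?thesis
      using c2 by (auto simp: split_beta cbox_Pair_eq intro!: continuous_intros)
  qed
  \<comment> \<open>The Schwarz formula is applied at every dilated point. After exchanging the
    integrals, the average of \<open>h\<close> at \<open>z\<close> is a superposition of averages of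
    \<open>cayley\<close> at the points \<open>w x\<close>, all of modulus \<open>norm z\<close>,
    with weight \<open>R x \<ge> 0\<close>.\<close>
  have "radial_avg b h z = integral {0..1} (\<lambda>t. integral {0..1} (\<lambda>x. of_real (R x) * cayley (of_real (dilation b t) * w x)))"
    unfolding radial_avg_def
  proof (rule integral_cong)
    fix t :: real assume t: "t \<in> {0..1}"
    have "norm (complex_of_real (dilation b t) * z) < 1"
      using norm_dilation_mult_le[OF b t, of z] z by simp
    from Schwarz_integral_formula[OF h real this]
    show "h (of_real (dilation b t) * z) = integral {0..1} (\<lambda>x. of_real (R x) * cayley (of_real (dilation b t) * w x))"
      by (simp add: R_def w_def integral_unique mult_ac)
  qed
  also have "\<dots> = integral {0..1} (\<lambda>x. integral {0..1} (\<lambda>t. of_real (R x) * cayley (of_real (dilation b t) * w x)))"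
    using integral_swap_continuous[OF cont] by simp
  also have "\<dots> = integral {0..1} (\<lambda>x. of_real (R x) * radial_avg b cayley (w x))"
    by (simp add: radial_avg_def)
  finally have eq: "radial_avg b h z = integral {0..1} (\<lambda>x. of_real (R x) * radial_avg b cayley (w x))" .
  have "continuous_on {0..1} (\<lambda>x. radial_avg b cayley (w x))"
    by (rule continuous_on_compose2[OF holomorphic_on_imp_continuous_on[OF
            radial_avg_holomorphic[OF b cayley_holomorphic]] continuous_on_subset[OF contw]])
      (use nw z in auto)
  then have "continuous_on {0..1} (\<lambda>x. of_real (R x) * radial_avg b cayley (w x))"
    by (intro continuous_intros continuous_on_subset[OF contR]) auto
  then have "((\<lambda>x. of_real (R x) * radial_avg b cayley (w x)) has_integral radial_avg b h z) {0..1}"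
    unfolding eq by (intro integrable_integral integrable_continuous_real)
  then have "((\<lambda>x. c * (of_real (R x) * radial_avg b cayley (w x))) has_integral c * radial_avg b h z) {0..1}"
    by (rule has_integral_mult_right)
  then have i1: "((\<lambda>x. Re (c * (of_real (R x) * radial_avg b cayley (w x)))) has_integral Re (c * radial_avg b h z)) {0..1}"
    by (rule has_integral_Re)
  \<comment> \<open>The mean value property gives the weight \<open>R\<close> the total mass
    \<open>Re (h 0)\<close>.\<close>
  have "((\<lambda>x. h (cis (2 * pi * x))) has_integral h 0) {0..1}"
    using h by (rule has_integral_unit_circle_mean)
  then have "(R has_integral Re (h 0)) {0..1}"
    unfolding R_def by (rule has_integral_Re)
  then have i2: "((\<lambda>x. R x * m) has_integral Re (h 0) * m) {0..1}"
    by (rule has_integral_mult_left)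
  show ?thesis
  proof (rule has_integral_le[OF i2 i1])
    fix x :: real
    have "R x * m \<le> R x * Re (c * radial_avg b cayley (w x))"
      by (intro mult_left_mono m nw) (simp add: R_def pos)
    also have "\<dots> = Re (c * (of_real (R x) * radial_avg b cayley (w x)))"
      by (simp add: algebra_simps)
    finally show "R x * m \<le> Re (c * (of_real (R x) * radial_avg b cayley (w x)))" .
  qed
qed

text \<open>The closed-disk version is applied to h(\<rho> z) and \<rho> tends to 1. Since h is
  dilated and z stays fixed, the same \<open>m\<close> serves for every \<rho>.\<close>

lemma radial_avg_bound:
  assumes b: "0 \<le> b" and h: "h holomorphic_on ball 0 1" and real: "Im (h 0) = 0"
    and pos: "\<And>z. norm z < 1 \<Longrightarrow> 0 \<le> Re (h z)" and z: "norm z < 1"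
    and m: "\<And>\<zeta>. norm \<zeta> = norm z \<Longrightarrow> m \<le> Re (c * radial_avg b cayley \<zeta>)"
  shows "Re (h 0) * m \<le> Re (c * radial_avg b h z)"
proof -
  have le: "Re (h 0) * m \<le> Re (c * radial_avg b h (of_real \<rho> * z))" if \<rho>: "0 < \<rho>" "\<rho> < 1" for \<rho>
  proof -
    define k where "k = (\<lambda>z. h (of_real \<rho> * z))"
    have inball: "complex_of_real \<rho> * u \<in> ball 0 1" if "norm u \<le> 1" for u
    proof -
      have "\<rho> * norm u \<le> \<rho> * 1" using that \<rho> by (intro mult_left_mono) auto
      moreover have "norm (complex_of_real \<rho> * u) = \<rho> * norm u" using \<rho> by (simp add: norm_mult)
      ultimately have "norm (complex_of_real \<rho> * u) < 1" using \<rho> by linarith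
      then show ?thesis by simp
    qed
    have "h \<circ> (\<lambda>z. of_real \<rho> * z) holomorphic_on cball 0 1"
    proof (rule holomorphic_on_compose_gen[OF _ h])
      show "(\<lambda>z. complex_of_real \<rho> * z) holomorphic_on cball 0 1" by (intro holomorphic_intros)
      show "(\<lambda>z. complex_of_real \<rho> * z) ` cball 0 1 \<subseteq> ball 0 1"
        using inball by (intro image_subsetI) simp
    qed
    then have "k holomorphic_on cball 0 1" by (simp add: k_def o_def)
    then have "Re (k 0) * m \<le> Re (c * radial_avg b k z)"
      using inball real by (intro radial_avg_bound_closed_disc b z m) (auto simp: k_def intro!: pos)
    then show ?thesis by (simp add: k_def radial_avg_def mult_ac)
  qed
  have zb: "z \<in> ball 0 1" using z by simp
  have "isCont (radial_avg b h) z"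
    using radial_avg_has_field_derivative[OF b h zb] by (rule DERIV_isCont)
  then have "isCont (radial_avg b h) (of_real 1 * z)" by simp
  then have "((\<lambda>\<rho>. radial_avg b h (of_real \<rho> * z)) \<longlongrightarrow> radial_avg b h (of_real 1 * z)) (at_left (1::real))"
    by (rule isCont_tendsto_compose) (intro tendsto_intros)
  then have lim: "((\<lambda>\<rho>. Re (c * radial_avg b h (of_real \<rho> * z))) \<longlongrightarrow> Re (c * radial_avg b h z)) (at_left (1::real))"
    by (auto intro!: tendsto_intros)
  show ?thesis
  proof (rule tendsto_lowerbound[OF lim])
    have "\<forall>\<^sub>F \<rho>::real in at_left 1. \<rho> \<in> {0<..<1}"
      by (rule eventually_at_left_real) simp
    then show "\<forall>\<^sub>F \<rho> in at_left 1. Re (h 0) * m \<le> Re (c * radial_avg b h (of_real \<rho> * z))"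
      by eventually_elim (rule le; simp)
  qed simp
qed

subsection \<open>The classes and their extremal functions\<close>

lemma class_A_quot:
  assumes f: "f \<in> class_A"
  shows "quot f holomorphic_on ball 0 1" "quot f 0 = 1"
    and "\<And>z. f z = z * quot f z"
    and "\<And>z. z \<in> ball 0 1 \<Longrightarrow> deriv f z = quot f z + z * deriv (quot f) z"
proof -
  have h: "f holomorphic_on ball 0 1" "f 0 = 0" "deriv f 0 = 1"
    using f by (auto simp: class_A_def)
  have "(f has_field_derivative deriv f 0) (at 0)"
    using h(1) by (intro holomorphic_derivI[of f "ball 0 1"]) auto
  then have "((\<lambda>w. f w / w) \<longlongrightarrow> 1) (at 0)"
    using h by (simp add: has_field_derivative_iff)
  then have L: "Lim (at 0) (\<lambda>w. f w / w) = 1" by (simp add: tendsto_Lim)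
  then show q0: "quot f 0 = 1" by (simp add: quot_def)
  \<comment> \<open>In this form \<open>quot f\<close> is the difference quotient of
    \<open>f\<close> at 0, whose singularity is removable.\<close>
  have "quot f = (\<lambda>z. if z = 0 then deriv f 0 else (f z - f 0) / (z - 0))"
    using h L by (auto simp: quot_def)
  then show hq: "quot f holomorphic_on ball 0 1"
    using pole_lemma[OF h(1), of 0] by simp
  show eq: "f z = z * quot f z" for z using h by (simp add: quot_def)
  fix z :: complex assume z: "z \<in> ball 0 1"
  have "(quot f has_field_derivative deriv (quot f) z) (at z)"
    using hq z by (intro holomorphic_derivI[of "quot f" "ball 0 1"]) auto
  then have "((\<lambda>z. z * quot f z) has_field_derivative quot f z + z * deriv (quot f) z) (at z)"
    by (auto intro!: derivative_eq_intros)
  then have "(f has_field_derivative quot f z + z * deriv (quot f) z) (at z)"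
    by (simp only: eq[symmetric])
  then show "deriv f z = quot f z + z * deriv (quot f) z" by (rule DERIV_imp_deriv)
qed

lemma class_A_times_id:
  assumes q: "q holomorphic_on ball 0 1" "q 0 = 1"
  shows "(\<lambda>z. z * q z) \<in> class_A"
    and "\<And>z. z \<in> ball 0 1 \<Longrightarrow> quot (\<lambda>z. z * q z) z = q z"
    and "\<And>z. z \<in> ball 0 1 \<Longrightarrow> deriv (quot (\<lambda>z. z * q z)) z = deriv q z"
proof -
  have d: "(q has_field_derivative deriv q 0) (at 0)"
    using q by (intro holomorphic_derivI[of q "ball 0 1"]) auto
  have "((\<lambda>z. z * q z) has_field_derivative 1) (at 0)"
    using d q by (auto intro!: derivative_eq_intros)
  then show A: "(\<lambda>z. z * q z) \<in> class_A"
    using q by (auto simp: class_A_def DERIV_imp_deriv intro!: holomorphic_intros)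
  show eq: "quot (\<lambda>z. z * q z) z = q z" if "z \<in> ball 0 1" for z
    using class_A_quot(2)[OF A] q by (cases "z = 0") (auto simp: quot_def)
  fix z :: complex assume z: "z \<in> ball 0 1"
  have "\<forall>\<^sub>F w in nhds z. w \<in> ball 0 1"
    using z by (intro eventually_nhds_in_open) auto
  then have "\<forall>\<^sub>F w in nhds z. quot (\<lambda>z. z * q z) w = q w"
    by eventually_elim (rule eq)
  then show "deriv (quot (\<lambda>z. z * q z)) z = deriv q z"
    by (rule deriv_cong_ev) simp
qed

text \<open>Inserting \<open>f z = z * quot f z\<close> puts the operator
  \<open>q + (1 - \<alpha>) z q'\<close> in place of the defining expression. At the added point 0
  it equals 1, and \<open>1 - l \<le> 1\<close> because \<open>0 \<le> l\<close>.\<close>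

lemma class_G_iff:
  assumes "0 \<le> l"
  shows "f \<in> class_G \<alpha> l \<longleftrightarrow> f \<in> class_A \<and>
    (\<forall>z\<in>ball 0 1. 1 - l \<le> Re (quot f z + of_real (1 - \<alpha>) * z * deriv (quot f) z))"
proof (cases "f \<in> class_A")
  case True
  have eq: "complex_of_real \<alpha> * (f z / z) + complex_of_real (1 - \<alpha>) * deriv f z =
      quot f z + of_real (1 - \<alpha>) * z * deriv (quot f) z" if "z \<in> ball 0 1 - {0}" for z
    using that class_A_quot(3)[OF True, of z] class_A_quot(4)[OF True, of z]
    by (simp add: algebra_simps)
  have "1 - l \<le> Re (quot f 0 + of_real (1 - \<alpha>) * 0 * deriv (quot f) 0)"
    using assms class_A_quot(2)[OF True] by simp
  then have "(\<forall>z\<in>ball 0 1. 1 - l \<le> Re (quot f z + of_real (1 - \<alpha>) * z * deriv (quot f) z)) \<longleftrightarrow>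
      (\<forall>z\<in>ball 0 1 - {0}. 1 - l \<le> Re (quot f z + of_real (1 - \<alpha>) * z * deriv (quot f) z))"
    by blast
  also have "\<dots> \<longleftrightarrow> (\<forall>z\<in>ball 0 1 - {0}.
      1 - l \<le> Re (complex_of_real \<alpha> * (f z / z) + complex_of_real (1 - \<alpha>) * deriv f z))"
    by (simp only: eq cong: ball_cong)
  finally show ?thesis using True by (simp add: class_G_def)
qed (simp add: class_G_def)

section \<open>Extremal functions and lower bounds in the classes\<close>

definition extremal :: "real \<Rightarrow> real \<Rightarrow> complex \<Rightarrow> complex" where
  "extremal \<alpha> l z = z * (of_real (1 - l) + of_real l * radial_avg (1 - \<alpha>) cayley z)"

lemma radial_avg_at_zero: "radial_avg b h 0 = h 0"
  by (simp add: radial_avg_def)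

lemma extremal_props:
  assumes "\<alpha> \<le> 1"
  shows "extremal \<alpha> l \<in> class_A"
    and "\<And>z. z \<in> ball 0 1 \<Longrightarrow>
      quot (extremal \<alpha> l) z = of_real (1 - l) + of_real l * radial_avg (1 - \<alpha>) cayley z"
    and "\<And>z. z \<in> ball 0 1 \<Longrightarrow>
      deriv (quot (extremal \<alpha> l)) z = of_real l * deriv (radial_avg (1 - \<alpha>) cayley) z"
    and "\<And>z. z \<in> ball 0 1 \<Longrightarrow>
      quot (extremal \<alpha> l) z + of_real (1 - \<alpha>) * z * deriv (quot (extremal \<alpha> l)) z =
      of_real (1 - l) + of_real l * cayley z"
proof -
  define T where "T = radial_avg (1 - \<alpha>) cayley"
  define q where "q = (\<lambda>z. of_real (1 - l) + of_real l * T z)"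
  have b: "0 \<le> 1 - \<alpha>" using assms by simp
  have T: "T holomorphic_on ball 0 1"
    unfolding T_def by (rule radial_avg_holomorphic[OF b cayley_holomorphic])
  have q: "q holomorphic_on ball 0 1" "q 0 = 1"
    unfolding q_def by (intro holomorphic_intros T) (simp add: T_def radial_avg_at_zero cayley_def)
  have ext: "extremal \<alpha> l = (\<lambda>z. z * q z)" by (auto simp: extremal_def q_def T_def)
  show "extremal \<alpha> l \<in> class_A" unfolding ext by (rule class_A_times_id[OF q])
  show a: "quot (extremal \<alpha> l) z = of_real (1 - l) + of_real l * radial_avg (1 - \<alpha>) cayley z"
    if "z \<in> ball 0 1" for z
    using class_A_times_id(2)[OF q that] by (simp add: ext q_def T_def)
  show d: "deriv (quot (extremal \<alpha> l)) z = of_real l * deriv (radial_avg (1 - \<alpha>) cayley) z"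
    if "z \<in> ball 0 1" for z
  proof -
    have "(T has_field_derivative deriv T z) (at z)"
      using T that by (intro holomorphic_derivI[of T "ball 0 1"]) auto
    then have "(q has_field_derivative of_real l * deriv T z) (at z)"
      unfolding q_def by (auto intro!: derivative_eq_intros)
    then show ?thesis
      using class_A_times_id(3)[OF q that] by (simp add: ext DERIV_imp_deriv T_def)
  qed
  show "quot (extremal \<alpha> l) z + of_real (1 - \<alpha>) * z * deriv (quot (extremal \<alpha> l)) z =
      of_real (1 - l) + of_real l * cayley z" if "z \<in> ball 0 1" for z
    unfolding a[OF that] d[OF that] radial_avg_ode[OF b cayley_holomorphic that, symmetric]
    by (simp only: distrib_left mult_ac add_ac)
qed

lemma extremal_in_class_G:
  assumes "\<alpha> \<le> 1" "0 \<le> l"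
  shows "extremal \<alpha> l \<in> class_G \<alpha> l"
proof -
  have "1 - l \<le> Re (of_real (1 - l) + of_real l * cayley z)" if "z \<in> ball 0 1" for z
  proof -
    have "0 \<le> (1 - norm z) / (1 + norm z)" using that by simp
    also have "\<dots> \<le> Re (cayley z)" using that by (intro Re_cayley_ge) auto
    finally show ?thesis using assms by simp
  qed
  then show ?thesis
    unfolding class_G_iff[OF assms(2)]
    by (intro conjI ballI extremal_props(1)[OF assms(1)]) (simp only: extremal_props(4)[OF assms(1)])
qed

text \<open>Subtracting \<open>1 - l\<close> from \<open>q + b z q'\<close> leaves a function with
  nonnegative real part and value \<open>l\<close> at 0. Its radial average is
  \<open>q - (1 - l)\<close>, to which \<open>radial_avg_bound\<close> applies.\<close>

lemma class_G_quot_bound: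
  assumes \<alpha>: "\<alpha> \<le> 1" and l: "0 \<le> l" and f: "f \<in> class_G \<alpha> l" and z: "norm z < 1"
    and m: "\<And>\<zeta>. norm \<zeta> = norm z \<Longrightarrow> m \<le> Re (c * radial_avg (1 - \<alpha>) cayley \<zeta>)"
  shows "(1 - l) * Re c + l * m \<le> Re (c * quot f z)"
proof -
  define b where "b = 1 - \<alpha>"
  have b: "0 \<le> b" using \<alpha> by (simp add: b_def)
  define q where "q = quot f"
  have A: "f \<in> class_A" using f by (simp add: class_G_def)
  have q: "q holomorphic_on ball 0 1" "q 0 = 1" unfolding q_def using class_A_quot[OF A] by auto
  define r where "r = (\<lambda>z. q z - of_real (1 - l))"
  define h where "h = (\<lambda>z. r z + of_real b * z * deriv r z)"
  have r: "r holomorphic_on ball 0 1" unfolding r_def by (intro holomorphic_intros q)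
  have h: "h holomorphic_on ball 0 1"
    unfolding h_def by (intro holomorphic_intros r holomorphic_deriv) auto
  have dr: "deriv r w = deriv q w" if "w \<in> ball 0 1" for w
  proof -
    have "(q has_field_derivative deriv q w) (at w)"
      using q that by (intro holomorphic_derivI[of q "ball 0 1"]) auto
    then have "(r has_field_derivative deriv q w) (at w)"
      unfolding r_def by (auto intro!: derivative_eq_intros)
    then show ?thesis by (rule DERIV_imp_deriv)
  qed
  have h0: "h 0 = of_real l" by (simp add: h_def r_def q)
  have "Re (h 0) * m \<le> Re (c * radial_avg b h z)"
  proof (rule radial_avg_bound[OF b h _ _ z])
    fix w :: complex assume "norm w < 1"
    then have w: "w \<in> ball 0 1" by simp
    have "1 - l \<le> Re (q w + of_real b * w * deriv q w)"
      using f l w by (simp add: class_G_iff q_def b_def)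
    then show "0 \<le> Re (h w)" using dr[OF w] by (simp add: h_def r_def)
  qed (use h0 m in \<open>auto simp: b_def\<close>)
  moreover have "radial_avg b h z = r z"
    unfolding h_def using z by (intro radial_avg_ode_inverse b r) simp
  ultimately show ?thesis by (simp add: h0 r_def q_def algebra_simps)
qed

lemma Re_radial_avg_cayley_ge:
  assumes b: "0 < b" and z: "norm z < 1"
  shows "integral {0..1} (cay b) \<le> Re (radial_avg b cayley z)"
proof -
  have "continuous_on {0..1} (\<lambda>t. cayley (of_real (dilation b t) * z))"
    using b z by (intro continuous_on_dilation_compose holomorphic_on_imp_continuous_on[OF cayley_holomorphic]) auto
  then have "((\<lambda>t. cayley (of_real (dilation b t) * z)) has_integral radial_avg b cayley z) {0..1}"
    unfolding radial_avg_def by (intro integrable_integral integrable_continuous_real)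
  then have i: "((\<lambda>t. Re (cayley (of_real (dilation b t) * z))) has_integral Re (radial_avg b cayley z)) {0..1}"
    by (rule has_integral_Re)
  have "(cay b has_integral integral {0..1} (cay b)) {0..1}"
    by (intro integrable_integral integrable_continuous_real continuous_on_cay b)
  then show ?thesis
  proof (rule has_integral_le[OF _ i])
    fix t :: real assume t: "t \<in> {0..1}"
    define d where "d = dilation b t"
    have d: "0 \<le> d" "d \<le> 1" using dilation_bounds[of b t] b t by (auto simp: d_def)
    show "cay b t \<le> Re (cayley (of_real (dilation b t) * z))"
    proof (cases "d = 1")
      \<comment> \<open>Here the bound to be shown is 0, and \<open>Re_cayley_ge\<close>, which asks
        for a radius below 1, is taken with radius \<open>norm z\<close>.\<close>
      case True
      have "0 \<le> (1 - norm z) / (1 + norm z)" using z by simp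
      also have "\<dots> \<le> Re (cayley z)" using z by (intro Re_cayley_ge) auto
      finally show ?thesis using True b by (simp add: cay_def d_def dilation_def split: if_splits)
    next
      case False
      have "norm (of_real d * z) \<le> d"
        using d z by (simp add: norm_mult mult_left_le)
      then have "(1 - d) / (1 + d) \<le> Re (cayley (of_real d * z))"
        using d False by (intro Re_cayley_ge) auto
      then show ?thesis using b by (simp add: cay_def d_def dilation_def)
    qed
  qed
qed

lemma class_G_Re_quot_ge:
  assumes "\<alpha> < 1" "0 \<le> l" "f \<in> class_G \<alpha> l" "norm z < 1"
  shows "1 - l + l * varkappa \<alpha> \<le> Re (quot f z)"
  using class_G_quot_bound[of \<alpha> l f z "varkappa \<alpha>" 1] assms Re_radial_avg_cayley_ge[of "1 - \<alpha>"]
  by (simp add: varkappa_eq_integral_cay)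

section \<open>Inclusions between the classes and their strictness\<close>

lemma class_G_mono_param: "l \<le> l' \<Longrightarrow> class_G \<alpha> l \<subseteq> class_G \<alpha> l'"
  by (force simp: class_G_def)

text \<open>It suffices to treat \<open>l = 1\<close>. Instead of \<open>varkappa\<close> the bound
  is \<open>(1 - norm z) / (1 + norm z)\<close>, which depends on \<open>z\<close> but is positive
  and also covers \<open>\<alpha> = 1\<close>.\<close>

lemma class_G_subset_class_G0:
  assumes \<alpha>: "\<alpha> \<le> 1" and l: "l \<le> 1"
  shows "class_G \<alpha> l \<subseteq> class_G0"
proof
  fix f assume f: "f \<in> class_G \<alpha> l"
  then have f1: "f \<in> class_G \<alpha> 1" using class_G_mono_param[OF l] by blast
  have b: "0 \<le> 1 - \<alpha>" using \<alpha> by simp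
  have "0 < Re (quot f z)" if z: "z \<in> ball 0 1" for z
  proof -
    define m where "m = (1 - norm z) / (1 + norm z)"
    have m: "0 < m" using z by (simp add: m_def add_pos_nonneg)
    have "m \<le> Re (1 * radial_avg (1 - \<alpha>) cayley \<zeta>)" if \<zeta>: "norm \<zeta> = norm z" for \<zeta>
    proof -
      have \<zeta>b: "\<zeta> \<in> ball 0 1" using \<zeta> z by simp
      have "continuous_on {0..1} (\<lambda>t. cayley (of_real (dilation (1 - \<alpha>) t) * \<zeta>))"
        by (intro continuous_on_dilation_compose b \<zeta>b holomorphic_on_imp_continuous_on[OF cayley_holomorphic])
      then have "((\<lambda>t. cayley (of_real (dilation (1 - \<alpha>) t) * \<zeta>)) has_integral
          radial_avg (1 - \<alpha>) cayley \<zeta>) {0..1}"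
        unfolding radial_avg_def by (intro integrable_integral integrable_continuous_real)
      then have i: "((\<lambda>t. Re (cayley (of_real (dilation (1 - \<alpha>) t) * \<zeta>))) has_integral
          Re (radial_avg (1 - \<alpha>) cayley \<zeta>)) {0..1}"
        by (rule has_integral_Re)
      have c: "((\<lambda>t. m) has_integral m) {0..1::real}" using has_integral_const_real[of m 0 1] by simp
      have "m \<le> Re (radial_avg (1 - \<alpha>) cayley \<zeta>)"
        by (rule has_integral_le[OF c i])
          (use norm_dilation_mult_le[OF b, of _ \<zeta>] \<zeta> z in \<open>auto simp: m_def intro!: Re_cayley_ge\<close>)
      then show ?thesis by simp
    qed
    then have "(1 - 1) * Re 1 + 1 * m \<le> Re (1 * quot f z)"
      using z by (intro class_G_quot_bound[OF \<alpha> _ f1]) auto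
    then show ?thesis using m by simp
  qed
  then show "f \<in> class_G0" using f by (simp add: class_G0_def class_G_def)
qed

lemma class_G_subset:
  assumes ab: "\<alpha> < \<alpha>'" "\<alpha>' \<le> 1" and l: "0 \<le> l" "0 \<le> l'"
    and le: "l * chi2 \<alpha> \<le> l' * chi2 \<alpha>'"
  shows "class_G \<alpha> l \<subseteq> class_G \<alpha>' l'"
proof
  fix f assume f: "f \<in> class_G \<alpha> l"
  have a1: "\<alpha> < 1" using ab by simp
  define b where "b = 1 - \<alpha>"
  define b' where "b' = 1 - \<alpha>'"
  have b: "0 < b" "0 \<le> b'" "b' < b" using ab by (auto simp: b_def b'_def)
  have A: "f \<in> class_A" using f by (simp add: class_G_def)
  have vk: "varkappa \<alpha> = b * chi2 \<alpha>" using a1 by (simp add: chi2_def b_def)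
  have pos: "0 < chi2 \<alpha>" "0 < chi2 \<alpha>'" using ab by (auto intro!: chi2_pos)
  \<comment> \<open>A rearrangement of \<open>chi2_diff_less\<close>. Multiplied by \<open>l\<close>
    and combined with \<open>le\<close>, it yields \<open>key\<close> after cancelling
    \<open>chi2 \<alpha>'\<close>.\<close>
  have "chi2 \<alpha>' * (1 - (b - b') * chi2 \<alpha>) \<le> chi2 \<alpha>"
    using chi2_diff_less[OF ab] by (simp add: b_def b'_def algebra_simps)
  then have "l * (chi2 \<alpha>' * (1 - (b - b') * chi2 \<alpha>)) \<le> l * chi2 \<alpha>"
    using l by (intro mult_left_mono)
  then have "(l * (1 - (b - b') * chi2 \<alpha>)) * chi2 \<alpha>' \<le> l' * chi2 \<alpha>'"
    using le by (simp add: mult_ac)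
  then have key: "l * (1 - (b - b') * chi2 \<alpha>) \<le> l'" using pos by simp
  have "1 - l' \<le> Re (quot f z + of_real b' * z * deriv (quot f) z)" if z: "z \<in> ball 0 1" for z
  proof -
    define d where "d = Re (z * deriv (quot f) z)"
    have re: "Re (quot f z + of_real c * z * deriv (quot f) z) = Re (quot f z) + c * d" for c
      by (simp add: d_def algebra_simps)
    have p: "1 - l \<le> Re (quot f z) + b * d"
      using f z unfolding class_G_iff[OF l(1)] b_def[symmetric] re[symmetric] by blast
    have q: "1 - l + l * (b * chi2 \<alpha>) \<le> Re (quot f z)"
      using class_G_Re_quot_ge[OF a1 l(1) f, of z] z by (simp add: vk)
    \<comment> \<open>The convex combination is cleared of its denominator: b (q + b' z q') = b' (q
      + b z q') + (b - b') q, with \<open>p\<close> and \<open>q\<close> bounding the two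
      summands.\<close>
    have "b * (1 - l') \<le> b * (1 - l * (1 - (b - b') * chi2 \<alpha>))"
      using key b by (intro mult_left_mono) auto
    also have "\<dots> = b' * (1 - l) + (b - b') * (1 - l + l * (b * chi2 \<alpha>))"
      by (simp add: algebra_simps)
    also have "\<dots> \<le> b' * (Re (quot f z) + b * d) + (b - b') * Re (quot f z)"
      using p q b by (intro add_mono mult_left_mono) auto
    also have "\<dots> = b * (Re (quot f z) + b' * d)" by (simp add: algebra_simps)
    finally have "1 - l' \<le> Re (quot f z) + b' * d" using b by simp
    then show ?thesis by (simp only: re)
  qed
  then show "f \<in> class_G \<alpha>' l'" using A l by (simp add: class_G_iff b'_def)
qed

text \<open>Along the radius towards \<open>1\<close> the functional defining \<open>class_G \<alpha>\<close>, evaluated at the extremal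
  function of \<open>class_G \<alpha>' l'\<close>, gets below \<open>1 - l' * (1 + (\<alpha>' - \<alpha>) * chi2 \<alpha>')\<close>, up to terms that
  vanish in the limit.\<close>

lemma extremal_class_G_imp:
  assumes ab: "\<alpha> < \<alpha>'" "\<alpha>' \<le> 1" and l: "0 \<le> l" "0 \<le> l'"
    and mem: "extremal \<alpha>' l' \<in> class_G \<alpha> l"
  shows "l' * (1 + (\<alpha>' - \<alpha>) * chi2 \<alpha>') \<le> l"
proof -
  define f where "f = extremal \<alpha>' l'"
  define k where "k = (\<lambda>x::real. (1 - x) / (1 + x))"
  have cx: "Re (cayley (of_real x)) = k x" for x
  proof -
    have "cayley (of_real x) = of_real (k x)" by (simp add: cayley_def k_def)
    then show ?thesis by simp
  qed
  have fG: "f \<in> class_G \<alpha>' l'" unfolding f_def using ab l by (intro extremal_in_class_G) auto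
  \<comment> \<open>\<open>B\<close> bounds the functional at the real point \<open>x\<close> from
    above. For \<open>\<alpha>' = 1\<close> the average is the identity and \<open>B\<close> is the
    exact value; otherwise the derivative term is estimated.\<close>
  define B where "B = (\<lambda>x::real. 1 - l' + l' * k x + (if \<alpha>' = 1
      then - (1 - \<alpha>) * l' * x * (2 / (1 + x)\<^sup>2)
      else (\<alpha>' - \<alpha>) / (1 - \<alpha>') * (l' * k x - l' * varkappa \<alpha>')))"
  have bd: "1 - l \<le> B x" if x: "x \<in> {0<..<1}" for x
  proof -
    have xb: "complex_of_real x \<in> ball 0 1" using x by simp
    define Q where "Q = Re (quot f (of_real x))"
    define d where "d = Re (of_real x * deriv (quot f) (of_real x))"
    have re: "Re (quot f (of_real x) + of_real c * of_real x * deriv (quot f) (of_real x)) = Q + c * d" for c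
      by (simp add: d_def Q_def algebra_simps)
    have p: "1 - l \<le> Q + (1 - \<alpha>) * d"
      using mem xb unfolding class_G_iff[OF l(1)] f_def[symmetric] re[symmetric] by blast
    have p': "Q + (1 - \<alpha>') * d = 1 - l' + l' * k x"
      unfolding re[symmetric] unfolding f_def extremal_props(4)[OF ab(2) xb] by (simp add: cx)
    show ?thesis
    proof (cases "\<alpha>' = 1")
      case True
      have av: "radial_avg 0 cayley = cayley" by (auto simp: radial_avg_def dilation_def)
      have "1 + complex_of_real x \<noteq> 0" using x by (auto simp: complex_eq_iff)
      then have "(cayley has_field_derivative - 2 / (1 + of_real x)\<^sup>2) (at (of_real x))"
        unfolding cayley_def[abs_def]
        by (auto intro!: derivative_eq_intros simp: power2_eq_square divide_simps)
      then have "deriv cayley (of_real x) = - 2 / (1 + of_real x)\<^sup>2" by (rule DERIV_imp_deriv)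
      then have "deriv (quot f) (of_real x) = of_real (l' * (- 2 / (1 + x)\<^sup>2))"
        using extremal_props(3)[OF ab(2) xb, of l'] by (simp add: True av f_def)
      then have "d = x * (l' * (- 2 / (1 + x)\<^sup>2))"
        unfolding d_def by (simp only: of_real_mult[symmetric] Re_complex_of_real)
      moreover define y where "y = 2 / (1 + x)\<^sup>2"
      ultimately have "d = - (x * (l' * y))" by simp
      then have "B x = Q + (1 - \<alpha>) * d"
        using p' True unfolding B_def y_def[symmetric] by (simp add: algebra_simps)
      then show ?thesis using p by simp
    next
      case False
      then have b': "0 < 1 - \<alpha>'" using ab by simp
      \<comment> \<open>By the equation \<open>p'\<close> a lower bound for \<open>Q\<close> is an
        upper bound for the derivative term \<open>d\<close>.\<close>
      have "1 - l' + l' * varkappa \<alpha>' \<le> Q"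
        unfolding Q_def using x b' l fG by (intro class_G_Re_quot_ge) auto
      then have "(1 - \<alpha>') * d \<le> l' * k x - l' * varkappa \<alpha>'" using p' by simp
      then have d: "d \<le> (l' * k x - l' * varkappa \<alpha>') / (1 - \<alpha>')"
        using b' by (simp add: field_simps)
      have "Q + (1 - \<alpha>) * d = 1 - l' + l' * k x + (\<alpha>' - \<alpha>) * d"
        using p' by (simp add: algebra_simps)
      also have "\<dots> \<le> B x"
        using mult_left_mono[OF d, of "\<alpha>' - \<alpha>"] ab False by (simp add: B_def)
      finally show ?thesis using p by simp
    qed
  qed
  have "isCont B 1"
    unfolding B_def k_def by (cases "\<alpha>' = 1") (auto intro!: continuous_intros)
  then have "(B \<longlongrightarrow> B 1) (at_left 1)"
    unfolding isCont_def by (rule tendsto_within_subset) simp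
  moreover have "\<forall>\<^sub>F x::real in at_left 1. 1 - l \<le> B x"
    using eventually_at_left_real[OF zero_less_one] by eventually_elim (rule bd)
  ultimately have "1 - l \<le> B 1" by (rule tendsto_lowerbound) simp
  moreover have "B 1 = 1 - l' * (1 + (\<alpha>' - \<alpha>) * chi2 \<alpha>')"
  proof (cases "\<alpha>' = 1")
    case True
    then show ?thesis by (simp add: B_def k_def chi2_one field_simps)
  next
    case False
    then have "chi2 \<alpha>' = varkappa \<alpha>' / (1 - \<alpha>')" using ab by (simp add: chi2_def)
    then show ?thesis using False by (simp add: B_def k_def algebra_simps)
  qed
  ultimately show ?thesis by simp
qed

text \<open>Membership would give \<open>l' * (1 + (\<alpha>' - \<alpha>) * chi2 \<alpha>') * chi2
  \<alpha> \<le> l' * chi2 \<alpha>'\<close>; cancelling \<open>l' > 0\<close> contradicts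
  \<open>chi2_diff_less\<close>.\<close>

lemma extremal_notin_class_G:
  assumes ab: "\<alpha> < \<alpha>'" "\<alpha>' \<le> 1" and l: "0 \<le> l" "0 < l'"
    and le: "l * chi2 \<alpha> \<le> l' * chi2 \<alpha>'"
  shows "extremal \<alpha>' l' \<notin> class_G \<alpha> l"
proof
  assume "extremal \<alpha>' l' \<in> class_G \<alpha> l"
  then have "l' * (1 + (\<alpha>' - \<alpha>) * chi2 \<alpha>') \<le> l"
    using ab l by (intro extremal_class_G_imp) auto
  then have "l' * (1 + (\<alpha>' - \<alpha>) * chi2 \<alpha>') * chi2 \<alpha> \<le> l * chi2 \<alpha>"
    using ab chi2_pos[of \<alpha>] by (intro mult_right_mono) auto
  also have "\<dots> \<le> l' * chi2 \<alpha>'" by (rule le)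
  finally have "l' * ((1 + (\<alpha>' - \<alpha>) * chi2 \<alpha>') * chi2 \<alpha>) \<le> l' * chi2 \<alpha>'" by (simp add: mult_ac)
  then have "(1 + (\<alpha>' - \<alpha>) * chi2 \<alpha>') * chi2 \<alpha> \<le> chi2 \<alpha>'" using l by simp
  then show False using chi2_diff_less[OF ab] by (simp add: algebra_simps)
qed

section \<open>Total extremality and the filtration theorem\<close>

lemma extremal_totally_extremal:
  assumes \<alpha>: "\<alpha> \<le> 1" and l: "0 \<le> l"
  shows "totally_extremal (class_G \<alpha> l) (extremal \<alpha> l)"
  unfolding totally_extremal_def
proof (intro conjI allI ballI)
  show "class_G \<alpha> l \<subseteq> class_A" by (auto simp: class_G_def)
  show "extremal \<alpha> l \<in> class_G \<alpha> l" using assms by (rule extremal_in_class_G)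
  fix c r f assume r: "r \<in> {0..<1::real}" and f: "f \<in> class_G \<alpha> l"
  define T where "T = radial_avg (1 - \<alpha>) cayley"
  have T: "continuous_on (sphere 0 r) T"
    unfolding T_def using \<alpha> r
    by (intro holomorphic_on_imp_continuous_on holomorphic_on_subset[OF radial_avg_holomorphic]
        cayley_holomorphic) auto
  have ne: "sphere (0::complex) r \<noteq> {}" using r by simp
  \<comment> \<open>The bound of \<open>class_G_quot_bound\<close> is used with \<open>m\<close> the
    attained minimum of \<open>Re (c * T w)\<close> on the circle. The extremal function takes the
    resulting value at \<zeta>, so no member of the class goes lower.\<close>
  obtain \<zeta> where \<zeta>: "\<zeta> \<in> sphere 0 r"
    and min: "\<And>w. w \<in> sphere 0 r \<Longrightarrow> Re (c * T \<zeta>) \<le> Re (c * T w)"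
  proof -
    have "continuous_on (sphere 0 r) (\<lambda>z. Re (c * T z))"
      by (intro continuous_intros T)
    then show thesis
      using continuous_attains_inf[OF compact_sphere ne] that by blast
  qed
  have val: "Re (c * quot (extremal \<alpha> l) z) = (1 - l) * Re c + l * Re (c * T z)"
    if "z \<in> sphere 0 r" for z
  proof -
    have "z \<in> ball 0 1" using that r by simp
    show ?thesis
      unfolding extremal_props(2)[OF \<alpha> \<open>z \<in> ball 0 1\<close>] T_def[symmetric]
      by (simp add: algebra_simps)
  qed
  have "circle_min c r (extremal \<alpha> l) \<le> Re (c * quot (extremal \<alpha> l) \<zeta>)"
    unfolding circle_min_def
  proof (rule cINF_lower[OF _ \<zeta>])
    show "bdd_below ((\<lambda>z. Re (c * quot (extremal \<alpha> l) z)) ` sphere 0 r)"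
    proof (rule bdd_belowI2)
      fix z :: complex assume z: "z \<in> sphere 0 r"
      show "(1 - l) * Re c + l * Re (c * T \<zeta>) \<le> Re (c * quot (extremal \<alpha> l) z)"
        unfolding val[OF z] by (intro add_left_mono mult_left_mono min z l)
    qed
  qed
  also have "\<dots> = (1 - l) * Re c + l * Re (c * T \<zeta>)" by (rule val[OF \<zeta>])
  also have "\<dots> \<le> circle_min c r f"
    unfolding circle_min_def
  proof (rule cINF_greatest[OF ne])
    fix z :: complex assume "z \<in> sphere 0 r"
    then have "norm z = r" by simp
    then show "(1 - l) * Re c + l * Re (c * T \<zeta>) \<le> Re (c * quot f z)"
      using r min unfolding T_def by (intro class_G_quot_bound[OF \<alpha> l f]) auto
  qed
  finally show "circle_min c r (extremal \<alpha> l) \<le> circle_min c r f" .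
qed

text \<open>For \<open>l = 0\<close> the condition forces \<open>quot f = 1\<close> on the disk
  whatever \<alpha> is. Two zeros of \<open>lam\<close> would thus give equal classes and spoil
  strictness, which the last hypothesis rules out.\<close>

theorem theorem4p25:
  fixes J :: "real set" and lam :: "real \<Rightarrow> real"
  assumes "is_interval J" and "J \<subseteq> {..1}"
    and "lam \<in> J \<rightarrow> {0..1}"
    and "continuous_on J lam"
    and "mono_on J (\<lambda>\<alpha>. lam \<alpha> * chi2 \<alpha>)"
    and "\<forall>\<alpha>\<in>J. \<forall>\<beta>\<in>J. lam \<alpha> = 0 \<and> lam \<beta> = 0 \<longrightarrow> \<alpha> = \<beta>"
  shows "strict_filtration_of class_G0 J (\<lambda>\<alpha>. class_G \<alpha> (lam \<alpha>))
    \<and> (\<forall>t\<in>J. filtration_boundary J (\<lambda>\<alpha>. class_G \<alpha> (lam \<alpha>)) t \<noteq> {})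
    \<and> admits_totally_extremal_net J (\<lambda>\<alpha>. class_G \<alpha> (lam \<alpha>))"
proof -
  have J: "\<alpha> \<le> 1" "0 \<le> lam \<alpha>" "lam \<alpha> \<le> 1" if "\<alpha> \<in> J" for \<alpha>
    using that assms(2,3) by auto
  have mono: "lam s * chi2 s \<le> lam t * chi2 t" if "s \<in> J" "t \<in> J" "s < t" for s t
    using mono_onD[OF assms(5)] that by simp
  \<comment> \<open>A zero of \<open>lam\<close> at \<open>t\<close> would, by monotonicity and
    \<open>chi2 s > 0\<close>, force a second zero at \<open>s\<close>.\<close>
  have pos: "0 < lam t" if st: "s \<in> J" "t \<in> J" "s < t" for s t
  proof (rule ccontr)
    assume "\<not> 0 < lam t"
    then have t: "lam t = 0" using J[OF st(2)] by simp
    then have "lam s * chi2 s \<le> 0" using mono[OF st] by simp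
    moreover have "0 < chi2 s" using J[OF st(1)] by (intro chi2_pos)
    ultimately have "lam s = 0" using J[OF st(1)] by (simp add: mult_le_0_iff)
    then show False using t assms(6) st by blast
  qed
  have ext: "extremal t (lam t) \<in> class_G t (lam t)" if "t \<in> J" for t
    using J[OF that] by (intro extremal_in_class_G)
  \<comment> \<open>The same function avoids all earlier classes at once, so it witnesses both
    strictness and the non-empty boundary at \<open>t\<close>.\<close>
  have notin: "extremal t (lam t) \<notin> class_G s (lam s)" if "s \<in> J" "t \<in> J" "s < t" for s t
    using that J mono pos by (intro extremal_notin_class_G) auto
  have subset: "class_G s (lam s) \<subseteq> class_G t (lam t)" if "s \<in> J" "t \<in> J" "s \<le> t" for s t
    using that J mono by (cases "s = t") (auto intro!: class_G_subset del: subsetI)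
  have "strict_filtration_of class_G0 J (\<lambda>\<alpha>. class_G \<alpha> (lam \<alpha>))"
    unfolding strict_filtration_of_def filtration_of_def
  proof (intro conjI ballI impI)
    fix s t assume "s \<in> J" "t \<in> J" "s < t"
    then show "class_G s (lam s) \<subset> class_G t (lam t)"
      using subset[of s t] ext[of t] notin[of s t] by auto
  qed (use J subset class_G_subset_class_G0 in auto)
  moreover have "\<forall>t\<in>J. filtration_boundary J (\<lambda>\<alpha>. class_G \<alpha> (lam \<alpha>)) t \<noteq> {}"
  proof
    fix t assume "t \<in> J"
    then have "extremal t (lam t) \<in> filtration_boundary J (\<lambda>\<alpha>. class_G \<alpha> (lam \<alpha>)) t"
      using ext notin by (auto simp: filtration_boundary_def)
    then show "filtration_boundary J (\<lambda>\<alpha>. class_G \<alpha> (lam \<alpha>)) t \<noteq> {}" by blast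
  qed
  moreover have "admits_totally_extremal_net J (\<lambda>\<alpha>. class_G \<alpha> (lam \<alpha>))"
    unfolding admits_totally_extremal_net_def
    using J extremal_totally_extremal by (intro exI[of _ "\<lambda>s. extremal s (lam s)"]) auto
  ultimately show ?thesis by blast
qed

end
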